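(* Let $n,m_1,m_2\ge 1$ be integers and let $S,T\in B(\mathcal H)$ satisfy $S^{*n}\,\triangle^{m_1}_{S^*,S}(I)\,S^n=0$ and $\triangle^{m_2}_{T^*,T}(I)=0$ (i.e. $S$ is $n$-quasi $m_1$-isometric and $T$ is $m_2$-isometric). (i) If $ST=TS$, then $(ST)^{*n}\,\triangle^{m_1+m_2-1}_{S^*T^*,\,ST}(I)\,(ST)^n=0$ (i.e. $ST$ is $n$-quasi $(m_1+m_2-1)$-isometric). (ii) $(S\otimes T)^{*n}\,\triangle^{m_1+m_2-1}_{S^*\otimes T^*,\,S\otimes T}(I\otimes I)\,(S\otimes T)^n=0$ (i.e. $S\otimes T$ is $n$-quasi $(m_1+m_2-1)$-isometric).
   Context: $\mathcal H$ is a complex infinite dimensional Hilbert space. For operators $A,B$ on a Hilbert space, $\triangle^m_{A,B}(I)=\sum_{j=0}^m(-1)^j\binom mj A^{m-j}B^{m-j}$, where $I$ is the identity. $S\otimes T$ denotes the tensor product operator on the Hilbert space tensor product of $\mathcal H$ with itself (whose identity operator is $I\otimes I$). *)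

theory Defs
  imports "HOL-Analysis.Analysis" "HOL-Library.Poly_Mapping"
begin

section \<open>Complex Hilbert spaces\<close>

text \<open>
  The inner product is linear in the first and conjugate-linear in the second argument.
  Building on \<^class>\<open>real_normed_vector\<close> makes the library's topology, completeness and
  \<^const>\<open>bounded_linear\<close> available; \<open>cinner_self\<close> says that the norm is the one induced
  by the inner product.
\<close>

class complex_inner = real_normed_vector +
  fixes scaleC :: "complex \<Rightarrow> 'a \<Rightarrow> 'a" (infixr "*\<^sub>C" 75)
    and cinner :: "'a \<Rightarrow> 'a \<Rightarrow> complex"
  assumes scaleC_add_right: "c *\<^sub>C (x + y) = c *\<^sub>C x + c *\<^sub>C y"
    and scaleC_add_left: "(c + d) *\<^sub>C x = c *\<^sub>C x + d *\<^sub>C x"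
    and scaleC_scaleC: "c *\<^sub>C d *\<^sub>C x = (c * d) *\<^sub>C x"
    and scaleC_one: "1 *\<^sub>C x = x"
    and scaleC_of_real: "complex_of_real r *\<^sub>C x = r *\<^sub>R x"
    and cinner_commute: "cinner y x = cnj (cinner x y)"
    and cinner_add_left: "cinner (x + y) z = cinner x z + cinner y z"
    and cinner_scaleC_left: "cinner (c *\<^sub>C x) y = c * cinner x y"
    and cinner_self: "cinner x x = complex_of_real ((norm x)\<^sup>2)"

class complex_hilbert_space = complex_inner + complete_space

global_interpretation complex_vector: vector_space "scaleC :: complex \<Rightarrow> 'a \<Rightarrow> 'a::complex_inner"
  defines cspan = complex_vector.span
  by unfold_locales
     (simp_all add: scaleC_add_right scaleC_add_left scaleC_scaleC scaleC_one)


section \<open>Operators\<close>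

definition bounded_clinear :: "('a::complex_inner \<Rightarrow> 'b::complex_inner) \<Rightarrow> bool" where
  "bounded_clinear A \<longleftrightarrow> bounded_linear A \<and> (\<forall>c x. A (c *\<^sub>C x) = c *\<^sub>C A x)"

text \<open>
  Uniqueness of the adjoint is immediate; on a \<^class>\<open>complex_hilbert_space\<close> it exists for
  every bounded operator by the Riesz representation theorem.
\<close>

definition adjoint_op :: "('a::complex_inner \<Rightarrow> 'a) \<Rightarrow> 'a \<Rightarrow> 'a" where
  "adjoint_op A = (THE B. bounded_clinear B \<and> (\<forall>x y. cinner (A x) y = cinner x (B y)))"

text \<open>\<open>defect m A B\<close> is \<open>\<triangle>\<^sup>m\<^bsub>A,B\<^esub>(I)\<close>.\<close>

definition defect :: "nat \<Rightarrow> ('a::complex_inner \<Rightarrow> 'a) \<Rightarrow> ('a \<Rightarrow> 'a) \<Rightarrow> 'a \<Rightarrow> 'a" where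
  "defect m A B = (\<lambda>x. \<Sum>j=0..m.
     ((-1) ^ j * of_nat (m choose j)) *\<^sub>C (A ^^ (m - j)) ((B ^^ (m - j)) x))"


section \<open>The Hilbert space tensor product\<close>

text \<open>
  The Hilbert space tensor product is constructed as the Hausdorff completion of the free complex
  vector space on \<open>'a \<times> 'b\<close> with respect to the positive semidefinite form determined by
  \<open>\<langle>(a, b), (a', b')\<rangle> = \<langle>a, a'\<rangle> \<langle>b, b'\<rangle>\<close>.  Dividing out the null vectors of that form yields the
  algebraic tensor product.
\<close>

subsection \<open>Semidefinite inner products\<close>

locale semi_inner = vector_space scale
  for scale :: "complex \<Rightarrow> 'v::ab_group_add \<Rightarrow> 'v" +
  fixes ip :: "'v \<Rightarrow> 'v \<Rightarrow> complex"
  assumes ip_commute: "ip y x = cnj (ip x y)"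
    and ip_add_left: "ip (x + y) z = ip x z + ip y z"
    and ip_scale_left: "ip (scale c x) y = c * ip x y"
    and ip_nonneg: "0 \<le> Re (ip x x)"
begin

lemma ip_add_right: "ip z (x + y) = ip z x + ip z y"
  by (metis ip_commute ip_add_left complex_cnj_add)

lemma ip_scale_right: "ip x (scale c y) = cnj c * ip x y"
  by (metis ip_commute ip_scale_left complex_cnj_mult)

lemma ip_uminus_left: "ip (- x) y = - ip x y"
  using ip_scale_left[of "-1" x y] by simp

lemma ip_uminus_right: "ip x (- y) = - ip x y"
  using ip_scale_right[of x "-1" y] by simp

lemma ip_diff_left: "ip (x - y) z = ip x z - ip y z"
  using ip_add_left[of x "- y" z] by (simp add: ip_uminus_left)

lemma ip_diff_right: "ip z (x - y) = ip z x - ip z y"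
  using ip_add_right[of z x "- y"] by (simp add: ip_uminus_right)

lemma ip_self_real: "ip x x = complex_of_real (Re (ip x x))"
  using ip_commute[of x x] by (simp add: complex_eq_iff)

definition snorm :: "'v \<Rightarrow> real" where
  "snorm x = sqrt (Re (ip x x))"

lemma snorm_ge0: "0 \<le> snorm x"
  by (simp add: snorm_def ip_nonneg)

lemma snorm_sq: "(snorm x)\<^sup>2 = Re (ip x x)"
  by (simp add: snorm_def ip_nonneg)

lemma snorm_scale: "snorm (scale c x) = cmod c * snorm x"
proof -
  have "ip (scale c x) (scale c x) = (c * cnj c) * ip x x"
    by (simp add: ip_scale_left ip_scale_right)
  also have "\<dots> = complex_of_real ((cmod c)\<^sup>2) * ip x x"
    by (simp add: complex_mult_cnj cmod_power2)
  finally have "Re (ip (scale c x) (scale c x)) = (cmod c)\<^sup>2 * Re (ip x x)"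
    by simp
  then show ?thesis
    by (simp add: snorm_def real_sqrt_mult)
qed

lemma snorm_uminus: "snorm (- x) = snorm x"
  by (simp add: snorm_def ip_uminus_left ip_uminus_right)

lemma snorm_diff_commute: "snorm (x - y) = snorm (y - x)"
  using snorm_uminus[of "x - y"] by simp

lemma snorm_0 [simp]: "snorm 0 = 0"
  using snorm_scale[of 0 0] by simp

lemma Cauchy_Schwarz: "cmod (ip x y) \<le> snorm x * snorm y"
proof -
  define b a d where "b = ip x y" and "a = Re (ip x x)" and "d = Re (ip y y)"
  have *: "0 \<le> a - 2 * s * (cmod b)\<^sup>2 + s\<^sup>2 * (cmod b)\<^sup>2 * d" for s :: real
  proof -
    define z where "z = complex_of_real s * b"
    have eq: "ip (x - scale z y) (x - scale z y) =
        ip x x - cnj z * b - z * cnj b + z * cnj z * ip y y"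
      by (simp add: ip_diff_left ip_diff_right ip_scale_left ip_scale_right
          ip_commute[of y x] b_def algebra_simps)
    have "Re (cnj z * b) = s * (cmod b)\<^sup>2" "Re (z * cnj b) = s * (cmod b)\<^sup>2"
      unfolding cmod_power2 by (simp_all add: z_def power2_eq_square algebra_simps)
    moreover have "Re (z * cnj z * ip y y) = s\<^sup>2 * (cmod b)\<^sup>2 * d"
    proof -
      have "z * cnj z = complex_of_real (s\<^sup>2 * (cmod b)\<^sup>2)"
        unfolding cmod_power2
        by (simp add: z_def power2_eq_square algebra_simps complex_eq_iff)
      then show ?thesis by (simp add: d_def)
    qed
    ultimately have "Re (ip (x - scale z y) (x - scale z y)) =
        a - 2 * s * (cmod b)\<^sup>2 + s\<^sup>2 * (cmod b)\<^sup>2 * d"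
      unfolding eq by (simp add: a_def)
    then show ?thesis using ip_nonneg by metis
  qed
  have "(cmod b)\<^sup>2 \<le> a * d"
  proof (cases "d = 0")
    case True
    have "cmod b = 0"
    proof (rule ccontr)
      assume "cmod b \<noteq> 0"
      then have "0 < (cmod b)\<^sup>2" by simp
      with *[of "(a + 1) / (2 * (cmod b)\<^sup>2)"] show False
        using True by (simp add: field_simps)
    qed
    then show ?thesis using True by simp
  next
    case False
    then have "0 < d" using ip_nonneg[of y] by (simp add: d_def)
    then show ?thesis
      using *[of "1 / d"] by (simp add: field_simps power2_eq_square)
  qed
  then have "(cmod b)\<^sup>2 \<le> (snorm x * snorm y)\<^sup>2"
    by (simp add: power_mult_distrib snorm_sq a_def d_def)
  then show ?thesis
    unfolding b_def by (rule power2_le_imp_le) (simp add: snorm_ge0)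
qed

lemma snorm_triangle: "snorm (x + y) \<le> snorm x + snorm y"
proof (rule power2_le_imp_le)
  have "Re (ip x y) \<le> snorm x * snorm y"
    using Cauchy_Schwarz[of x y] complex_Re_le_cmod order_trans by blast
  moreover have "Re (ip y x) = Re (ip x y)"
    by (subst ip_commute) simp
  ultimately show "(snorm (x + y))\<^sup>2 \<le> (snorm x + snorm y)\<^sup>2"
    by (simp add: snorm_sq power2_sum ip_add_left ip_add_right)
qed (simp add: snorm_ge0)

lemma snorm_triangle_diff: "snorm (x - z) \<le> snorm (x - y) + snorm (y - z)"
  using snorm_triangle[of "x - y" "y - z"] by simp

lemma snorm_diff_abs: "\<bar>snorm x - snorm y\<bar> \<le> snorm (x - y)"
  using snorm_triangle[of "x - y" y] snorm_triangle[of "y - x" x]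
  by (auto simp: snorm_diff_commute[of x y] abs_le_iff)

definition cauchy_seq :: "(nat \<Rightarrow> 'v) \<Rightarrow> bool" where
  "cauchy_seq X \<longleftrightarrow> (\<forall>e>0. \<exists>M. \<forall>m\<ge>M. \<forall>n\<ge>M. snorm (X m - X n) < e)"

definition cauchy_equiv :: "(nat \<Rightarrow> 'v) \<Rightarrow> (nat \<Rightarrow> 'v) \<Rightarrow> bool" where
  "cauchy_equiv X Y \<longleftrightarrow> cauchy_seq X \<and> cauchy_seq Y \<and> (\<lambda>n. snorm (X n - Y n)) \<longlonglongrightarrow> 0"

lemma cauchy_seq_const: "cauchy_seq (\<lambda>_. x)"
  by (simp add: cauchy_seq_def)

lemma cauchy_equiv_refl: "cauchy_equiv X X \<longleftrightarrow> cauchy_seq X"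
  by (simp add: cauchy_equiv_def)

lemma null_bound:
  assumes "f \<longlonglongrightarrow> 0" "\<And>n. cmod (g n) \<le> f n"
  shows "g \<longlonglongrightarrow> 0"
  by (rule Lim_null_comparison[OF _ assms(1)]) (simp add: assms(2))

lemma null_bound_real:
  assumes "f \<longlonglongrightarrow> 0" "\<And>n. snorm (g n) \<le> f n"
  shows "(\<lambda>n. snorm (g n)) \<longlonglongrightarrow> 0"
  by (rule Lim_null_comparison[OF _ assms(1)]) (simp add: assms(2) snorm_ge0)

lemma cauchy_equiv_part_equivp: "part_equivp cauchy_equiv"
proof (rule part_equivpI)
  show "\<exists>X. cauchy_equiv X X"
    using cauchy_equiv_refl cauchy_seq_const by blast
  show "symp cauchy_equiv"
    by (rule sympI) (simp add: cauchy_equiv_def snorm_diff_commute)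
  show "transp cauchy_equiv"
  proof (rule transpI)
    fix X Y Z assume XY: "cauchy_equiv X Y" and YZ: "cauchy_equiv Y Z"
    have "(\<lambda>n. snorm (X n - Y n) + snorm (Y n - Z n)) \<longlonglongrightarrow> 0 + 0"
      using XY YZ unfolding cauchy_equiv_def by (intro tendsto_add) auto
    then have "(\<lambda>n. snorm (X n - Z n)) \<longlonglongrightarrow> 0"
      by (intro null_bound_real) (auto intro: snorm_triangle_diff)
    with XY YZ show "cauchy_equiv X Z"
      by (simp add: cauchy_equiv_def)
  qed
qed

lemma cauchy_seq_add:
  assumes "cauchy_seq X" "cauchy_seq Y"
  shows "cauchy_seq (\<lambda>n. X n + Y n)"
  unfolding cauchy_seq_def
proof (intro allI impI)
  fix e :: real assume "e > 0"
  obtain M where M: "\<forall>m\<ge>M. \<forall>n\<ge>M. snorm (X m - X n) < e / 2"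
    using assms(1) \<open>e > 0\<close> unfolding cauchy_seq_def by (meson half_gt_zero)
  obtain N where N: "\<forall>m\<ge>N. \<forall>n\<ge>N. snorm (Y m - Y n) < e / 2"
    using assms(2) \<open>e > 0\<close> unfolding cauchy_seq_def by (meson half_gt_zero)
  have "snorm (X m + Y m - (X n + Y n)) < e" if "m \<ge> max M N" "n \<ge> max M N" for m n
  proof -
    have "snorm (X m + Y m - (X n + Y n)) \<le> snorm (X m - X n) + snorm (Y m - Y n)"
      using snorm_triangle[of "X m - X n" "Y m - Y n"] by (simp add: algebra_simps)
    moreover have "snorm (X m - X n) < e / 2" "snorm (Y m - Y n) < e / 2"
      using that M N by auto
    ultimately show ?thesis by linarith
  qed
  then show "\<exists>M. \<forall>m\<ge>M. \<forall>n\<ge>M. snorm (X m + Y m - (X n + Y n)) < e" by blast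
qed

lemma cauchy_seq_scale:
  assumes "cauchy_seq X"
  shows "cauchy_seq (\<lambda>n. scale c (X n))"
  unfolding cauchy_seq_def
proof (intro allI impI)
  fix e :: real assume "e > 0"
  then have "e / (cmod c + 1) > 0"
    by (intro divide_pos_pos) (auto intro: add_nonneg_pos)
  then obtain M where M: "\<forall>m\<ge>M. \<forall>n\<ge>M. snorm (X m - X n) < e / (cmod c + 1)"
    using assms unfolding cauchy_seq_def by blast
  have "snorm (scale c (X m) - scale c (X n)) < e" if "m \<ge> M" "n \<ge> M" for m n
  proof -
    have pos: "cmod c + 1 > 0" by (simp add: add_nonneg_pos)
    have "snorm (scale c (X m) - scale c (X n)) = cmod c * snorm (X m - X n)"
      by (simp add: snorm_scale flip: scale_right_diff_distrib)
    also have "\<dots> \<le> (cmod c + 1) * snorm (X m - X n)"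
      by (simp add: mult_right_mono snorm_ge0)
    also have "\<dots> < e"
      using M that pos by (simp add: pos_less_divide_eq mult.commute)
    finally show ?thesis .
  qed
  then show "\<exists>M. \<forall>m\<ge>M. \<forall>n\<ge>M. snorm (scale c (X m) - scale c (X n)) < e" by blast
qed

lemma cauchy_equiv_add:
  assumes "cauchy_equiv X X'" "cauchy_equiv Y Y'"
  shows "cauchy_equiv (\<lambda>n. X n + Y n) (\<lambda>n. X' n + Y' n)"
proof -
  have "(\<lambda>n. snorm (X n - X' n) + snorm (Y n - Y' n)) \<longlonglongrightarrow> 0 + 0"
    using assms unfolding cauchy_equiv_def by (intro tendsto_add) auto
  moreover have "snorm (X n + Y n - (X' n + Y' n)) \<le> snorm (X n - X' n) + snorm (Y n - Y' n)" for n
    using snorm_triangle[of "X n - X' n" "Y n - Y' n"] by (simp add: algebra_simps)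
  ultimately have "(\<lambda>n. snorm (X n + Y n - (X' n + Y' n))) \<longlonglongrightarrow> 0"
    by (intro null_bound_real) auto
  with assms show ?thesis
    by (simp add: cauchy_equiv_def cauchy_seq_add)
qed

lemma cauchy_equiv_scale:
  assumes "cauchy_equiv X X'"
  shows "cauchy_equiv (\<lambda>n. scale c (X n)) (\<lambda>n. scale c (X' n))"
proof -
  have "(\<lambda>n. cmod c * snorm (X n - X' n)) \<longlonglongrightarrow> cmod c * 0"
    using assms unfolding cauchy_equiv_def by (intro tendsto_mult) auto
  then have "(\<lambda>n. snorm (scale c (X n) - scale c (X' n))) \<longlonglongrightarrow> 0"
    by (simp add: snorm_scale flip: scale_right_diff_distrib)
  with assms show ?thesis
    by (simp add: cauchy_equiv_def cauchy_seq_scale)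
qed

lemma cauchy_equiv_uminus:
  assumes "cauchy_equiv X X'"
  shows "cauchy_equiv (\<lambda>n. - X n) (\<lambda>n. - X' n)"
  using cauchy_equiv_scale[OF assms, of "-1"] by simp

lemma cauchy_seq_bounded:
  assumes "cauchy_seq X"
  obtains B where "B > 0" "\<And>n. snorm (X n) \<le> B"
proof -
  have "Cauchy (\<lambda>n. snorm (X n))"
    unfolding Cauchy_def dist_real_def
  proof (intro allI impI)
    fix e :: real assume "e > 0"
    then obtain M where "\<forall>m\<ge>M. \<forall>n\<ge>M. snorm (X m - X n) < e"
      using assms unfolding cauchy_seq_def by blast
    then show "\<exists>M. \<forall>m\<ge>M. \<forall>n\<ge>M. \<bar>snorm (X m) - snorm (X n)\<bar> < e"
      using snorm_diff_abs le_less_trans by blast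
  qed
  then have "Bseq (\<lambda>n. snorm (X n))" by (rule Cauchy_Bseq)
  then obtain B where "B > 0" "\<And>n. norm (snorm (X n)) \<le> B" by (auto elim: BseqE)
  then show ?thesis using that by (simp add: snorm_ge0)
qed

lemma ip_diff_bound:
  "cmod (ip x y - ip x' y') \<le> snorm (x - x') * snorm y + snorm x' * snorm (y - y')"
proof -
  have "ip x y - ip x' y' = ip (x - x') y + ip x' (y - y')"
    by (simp add: ip_diff_left ip_diff_right)
  then have "cmod (ip x y - ip x' y') \<le> cmod (ip (x - x') y) + cmod (ip x' (y - y'))"
    by (simp add: norm_triangle_ineq)
  then show ?thesis
    using Cauchy_Schwarz[of "x - x'" y] Cauchy_Schwarz[of x' "y - y'"] by linarith
qed

lemma ip_convergent:
  assumes "cauchy_seq X" "cauchy_seq Y"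
  shows "convergent (\<lambda>n. ip (X n) (Y n))"
proof (rule Cauchy_convergent, unfold Cauchy_def dist_norm, intro allI impI)
  fix e :: real assume "e > 0"
  obtain B where B: "B > 0" "\<And>n. snorm (X n) \<le> B" by (rule cauchy_seq_bounded[OF assms(1)]) blast
  obtain C where C: "C > 0" "\<And>n. snorm (Y n) \<le> C" by (rule cauchy_seq_bounded[OF assms(2)]) blast
  have "e / (2 * C) > 0" "e / (2 * B) > 0" using \<open>e > 0\<close> B C by auto
  then obtain M N where M: "\<forall>m\<ge>M. \<forall>n\<ge>M. snorm (X m - X n) < e / (2 * C)"
    and N: "\<forall>m\<ge>N. \<forall>n\<ge>N. snorm (Y m - Y n) < e / (2 * B)"
    using assms unfolding cauchy_seq_def by meson
  have "cmod (ip (X m) (Y m) - ip (X n) (Y n)) < e" if "m \<ge> max M N" "n \<ge> max M N" for m n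
  proof -
    have "snorm (X m - X n) * snorm (Y m) \<le> snorm (X m - X n) * C"
      by (simp add: C mult_left_mono snorm_ge0)
    also have "\<dots> < e / (2 * C) * C"
      using M that C by (intro mult_strict_right_mono) auto
    also have "\<dots> = e / 2" using C by simp
    finally have 1: "snorm (X m - X n) * snorm (Y m) < e / 2" .
    have "snorm (X n) * snorm (Y m - Y n) \<le> B * snorm (Y m - Y n)"
      by (simp add: B mult_right_mono snorm_ge0)
    also have "\<dots> < B * (e / (2 * B))"
      using N that B by (intro mult_strict_left_mono) auto
    also have "\<dots> = e / 2" using B by simp
    finally have 2: "snorm (X n) * snorm (Y m - Y n) < e / 2" .
    from 1 2 ip_diff_bound[of "X m" "Y m" "X n" "Y n"] show ?thesis by linarith
  qed
  then show "\<exists>M. \<forall>m\<ge>M. \<forall>n\<ge>M. cmod (ip (X m) (Y m) - ip (X n) (Y n)) < e" by blast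
qed

lemma ip_tendsto:
  assumes "cauchy_seq X" "cauchy_seq Y"
  shows "(\<lambda>n. ip (X n) (Y n)) \<longlonglongrightarrow> lim (\<lambda>n. ip (X n) (Y n))"
  using ip_convergent[OF assms] by (simp add: convergent_LIMSEQ_iff)

lemma ip_lim_cong:
  assumes "cauchy_equiv X X'" "cauchy_equiv Y Y'"
  shows "lim (\<lambda>n. ip (X n) (Y n)) = lim (\<lambda>n. ip (X' n) (Y' n))"
proof -
  have c: "cauchy_seq X" "cauchy_seq X'" "cauchy_seq Y" "cauchy_seq Y'"
    using assms by (auto simp: cauchy_equiv_def)
  obtain B where B: "\<And>n. snorm (X' n) \<le> B" by (rule cauchy_seq_bounded[OF c(2)]) blast
  obtain C where C: "\<And>n. snorm (Y n) \<le> C" by (rule cauchy_seq_bounded[OF c(3)]) blast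
  have "(\<lambda>n. snorm (X n - X' n) * C + B * snorm (Y n - Y' n)) \<longlonglongrightarrow> 0 * C + B * 0"
    using assms unfolding cauchy_equiv_def by (intro tendsto_intros) auto
  moreover have "cmod (ip (X n) (Y n) - ip (X' n) (Y' n)) \<le>
      snorm (X n - X' n) * C + B * snorm (Y n - Y' n)" for n
    using ip_diff_bound[of "X n" "Y n" "X' n" "Y' n"]
      mult_left_mono[OF C[of n] snorm_ge0[of "X n - X' n"]]
      mult_right_mono[OF B[of n] snorm_ge0[of "Y n - Y' n"]] by linarith
  ultimately have "(\<lambda>n. ip (X n) (Y n) - ip (X' n) (Y' n)) \<longlonglongrightarrow> 0"
    by (intro null_bound) auto
  moreover have "(\<lambda>n. ip (X n) (Y n) - ip (X' n) (Y' n)) \<longlonglongrightarrow>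
      lim (\<lambda>n. ip (X n) (Y n)) - lim (\<lambda>n. ip (X' n) (Y' n))"
    by (intro tendsto_diff ip_tendsto c)
  ultimately show ?thesis
    using LIMSEQ_unique by fastforce
qed

end


global_interpretation cinner: semi_inner scaleC "cinner :: 'a::complex_inner \<Rightarrow> 'a \<Rightarrow> complex"
  rewrites "cinner.snorm = (norm :: 'a \<Rightarrow> real)"
proof -
  show *: "semi_inner scaleC (cinner :: 'a \<Rightarrow> 'a \<Rightarrow> complex)"
    by unfold_locales
       (simp_all add: cinner_add_left cinner_scaleC_left cinner_self flip: cinner_commute)
  show "semi_inner.snorm cinner = (norm :: 'a \<Rightarrow> real)"
    by (simp add: fun_eq_iff semi_inner.snorm_def[OF *] cinner_self)
qed

lemma cinner_sum_left: "cinner (\<Sum>i\<in>I. f i) y = (\<Sum>i\<in>I. cinner (f i) y)"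
  by (induction I rule: infinite_finite_induct)
     (use cinner_scaleC_left[of 0 0 y] in \<open>auto simp: cinner_add_left\<close>)

lemma cinner_sum_right: "cinner x (\<Sum>i\<in>I. f i) = (\<Sum>i\<in>I. cinner x (f i))"
  by (subst cinner_commute) (simp add: cinner_sum_left flip: cinner_commute)

lemma cinner_0 [simp]: "cinner 0 y = 0" "cinner x 0 = 0"
  using cinner_sum_left[of "\<lambda>_. 0" "{}" y] cinner_sum_right[of x "\<lambda>_. 0" "{}"] by simp_all

lemma orthonormal_expansion_exists:
  fixes A :: "'a::complex_inner set"
  assumes "finite A"
  shows "\<exists>E. finite E \<and> (\<forall>e\<in>E. \<forall>e'\<in>E. cinner e e' = (if e = e' then 1 else 0)) \<and>
    (\<forall>a\<in>A. a = (\<Sum>e\<in>E. cinner a e *\<^sub>C e))"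
  using assms
proof (induction A rule: finite_induct)
  case empty
  show ?case by (intro exI[of _ "{}"]) simp
next
  case (insert a A)
  then obtain E where fin: "finite E"
    and on: "\<And>e e'. e \<in> E \<Longrightarrow> e' \<in> E \<Longrightarrow> cinner e e' = (if e = e' then 1 else 0)"
    and ex: "\<And>x. x \<in> A \<Longrightarrow> x = (\<Sum>e\<in>E. cinner x e *\<^sub>C e)"
    by metis
  define u where "u = a - (\<Sum>e\<in>E. cinner a e *\<^sub>C e)"
  have u_orth: "cinner u e = 0" if "e \<in> E" for e
  proof -
    have "(\<Sum>d\<in>E. cinner a d * cinner d e) = (\<Sum>d\<in>E. if d = e then cinner a d else 0)"
      by (intro sum.cong) (auto simp: on that)
    also have "\<dots> = cinner a e" using fin that by simp
    finally show ?thesis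
      by (simp add: u_def cinner.ip_diff_left cinner_sum_left cinner_scaleC_left)
  qed
  show ?case
  proof (cases "u = 0")
    case True
    then have "a = (\<Sum>e\<in>E. cinner a e *\<^sub>C e)" by (simp add: u_def)
    then show ?thesis using fin on ex by (intro exI[of _ E]) auto
  next
    case False
    define v where "v = complex_of_real (1 / norm u) *\<^sub>C u"
    have nz: "norm u \<noteq> 0" using False by simp
    have v_orth: "cinner v e = 0" if "e \<in> E" for e
      by (simp add: v_def cinner_scaleC_left u_orth that)
    have v_orth': "cinner e v = 0" if "e \<in> E" for e
      by (subst cinner_commute) (simp add: v_orth that)
    have uv: "cinner u v = complex_of_real (norm u)"
      using nz unfolding v_def cinner.ip_scale_right cinner_self
      by (simp add: power2_eq_square)
    then have vv: "cinner v v = 1"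
      using nz by (subst v_def) (simp add: cinner_scaleC_left)
    have vnotin: "v \<notin> E" using v_orth vv by fastforce
    have expand_v: "(\<Sum>e\<in>insert v E. cinner x e *\<^sub>C e) = cinner x v *\<^sub>C v + (\<Sum>e\<in>E. cinner x e *\<^sub>C e)" for x
      using fin vnotin by simp
    have A_v: "cinner x v = 0" if "x \<in> A" for x
      by (subst ex[OF that]) (simp add: cinner_sum_left cinner_scaleC_left v_orth')
    have a_eq: "a = u + (\<Sum>e\<in>E. cinner a e *\<^sub>C e)" by (simp add: u_def)
    have "cinner a v = cinner u v"
      by (subst a_eq) (simp add: cinner_add_left cinner_sum_left cinner_scaleC_left v_orth')
    also note uv
    finally have "cinner a v *\<^sub>C v = u"
      using nz by (simp add: v_def)
    then have "a = (\<Sum>e\<in>insert v E. cinner a e *\<^sub>C e)"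
      using a_eq by (simp add: expand_v)
    moreover have "x = (\<Sum>e\<in>insert v E. cinner x e *\<^sub>C e)" if "x \<in> A" for x
      using ex[OF that] by (simp only: expand_v A_v[OF that]) simp
    moreover have "\<forall>e\<in>insert v E. \<forall>e'\<in>insert v E. cinner e e' = (if e = e' then 1 else 0)"
      using on vv v_orth v_orth' vnotin by auto
    ultimately show ?thesis
      using fin by (intro exI[of _ "insert v E"]) blast
  qed
qed


subsection \<open>The form on the free vector space\<close>

definition fscale :: "complex \<Rightarrow> ('p \<Rightarrow>\<^sub>0 complex) \<Rightarrow> ('p \<Rightarrow>\<^sub>0 complex)" where
  "fscale c f = Poly_Mapping.map ((*) c) f"

lemma lookup_fscale [simp]: "Poly_Mapping.lookup (fscale c f) p = c * Poly_Mapping.lookup f p"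
  by (simp add: fscale_def Poly_Mapping.map.rep_eq when_def)

lemma fscale_single: "fscale c (Poly_Mapping.single p d) = Poly_Mapping.single p (c * d)"
  by (rule poly_mapping_eqI) (simp add: lookup_single when_def)

lemma keys_fscale: "Poly_Mapping.keys (fscale c f) \<subseteq> Poly_Mapping.keys f"
  by (auto simp: in_keys_iff)

global_interpretation fscale: vector_space fscale
  by unfold_locales
     (auto intro!: poly_mapping_eqI simp: lookup_add algebra_simps)

definition tensor_form ::
  "('a::complex_inner \<times> 'b::complex_inner \<Rightarrow>\<^sub>0 complex) \<Rightarrow> ('a \<times> 'b \<Rightarrow>\<^sub>0 complex) \<Rightarrow> complex" where
  "tensor_form f g = (\<Sum>p\<in>Poly_Mapping.keys f. \<Sum>q\<in>Poly_Mapping.keys g.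
     Poly_Mapping.lookup f p * cnj (Poly_Mapping.lookup g q) * (cinner (fst p) (fst q) * cinner (snd p) (snd q)))"

lemma tensor_form_superset:
  assumes "finite P" "Poly_Mapping.keys f \<subseteq> P" "finite Q" "Poly_Mapping.keys g \<subseteq> Q"
  shows "tensor_form f g = (\<Sum>p\<in>P. \<Sum>q\<in>Q.
     Poly_Mapping.lookup f p * cnj (Poly_Mapping.lookup g q) * (cinner (fst p) (fst q) * cinner (snd p) (snd q)))"
proof -
  have "tensor_form f g = (\<Sum>p\<in>Poly_Mapping.keys f. \<Sum>q\<in>Q.
     Poly_Mapping.lookup f p * cnj (Poly_Mapping.lookup g q) * (cinner (fst p) (fst q) * cinner (snd p) (snd q)))"
    unfolding tensor_form_def
    by (intro sum.cong sum.mono_neutral_left refl assms) (auto simp: in_keys_iff)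
  also have "\<dots> = (\<Sum>p\<in>P. \<Sum>q\<in>Q.
     Poly_Mapping.lookup f p * cnj (Poly_Mapping.lookup g q) * (cinner (fst p) (fst q) * cinner (snd p) (snd q)))"
    by (intro sum.mono_neutral_left refl assms) (auto simp: in_keys_iff)
  finally show ?thesis .
qed

lemma tensor_form_nonneg: "0 \<le> Re (tensor_form f f)"
proof -
  let ?P = "Poly_Mapping.keys f"
  obtain E where ex: "\<forall>a\<in>fst ` ?P. a = (\<Sum>e\<in>E. cinner a e *\<^sub>C e)"
    using orthonormal_expansion_exists[of "fst ` ?P"] by auto
  have parseval: "cinner a a' = (\<Sum>e\<in>E. cinner a e * cnj (cinner a' e))" if "a \<in> fst ` ?P" for a a'
  proof -
    have "cinner a a' = cinner (\<Sum>e\<in>E. cinner a e *\<^sub>C e) a'"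
      using ex that by (intro arg_cong2[where f = cinner]) auto
    also have "\<dots> = (\<Sum>e\<in>E. cinner a e * cnj (cinner a' e))"
      by (simp add: cinner_sum_left cinner_scaleC_left flip: cinner_commute)
    finally show ?thesis .
  qed
  define w where "w e = (\<Sum>p\<in>?P. (Poly_Mapping.lookup f p * cinner (fst p) e) *\<^sub>C snd p)" for e
  have "tensor_form f f = (\<Sum>p\<in>?P. \<Sum>q\<in>?P. \<Sum>e\<in>E.
      Poly_Mapping.lookup f p * cnj (Poly_Mapping.lookup f q) * (cinner (fst p) e * cnj (cinner (fst q) e) * cinner (snd p) (snd q)))"
    unfolding tensor_form_def
    by (intro sum.cong refl) (simp add: parseval sum_distrib_left sum_distrib_right)
  also have "\<dots> = (\<Sum>p\<in>?P. \<Sum>e\<in>E. \<Sum>q\<in>?P.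
      Poly_Mapping.lookup f p * cnj (Poly_Mapping.lookup f q) * (cinner (fst p) e * cnj (cinner (fst q) e) * cinner (snd p) (snd q)))"
    by (intro sum.cong refl sum.swap)
  also have "\<dots> = (\<Sum>e\<in>E. \<Sum>p\<in>?P. \<Sum>q\<in>?P.
      Poly_Mapping.lookup f p * cnj (Poly_Mapping.lookup f q) * (cinner (fst p) e * cnj (cinner (fst q) e) * cinner (snd p) (snd q)))"
    by (rule sum.swap)
  also have "\<dots> = (\<Sum>e\<in>E. cinner (w e) (w e))"
  proof (intro sum.cong refl)
    fix e assume "e \<in> E"
    have "cinner (w e) (w e) = (\<Sum>p\<in>?P. cinner ((Poly_Mapping.lookup f p * cinner (fst p) e) *\<^sub>C snd p) (w e))"
      by (subst (1) w_def) (rule cinner_sum_left)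
    also have "\<dots> = (\<Sum>p\<in>?P. \<Sum>q\<in>?P.
      Poly_Mapping.lookup f p * cnj (Poly_Mapping.lookup f q) * (cinner (fst p) e * cnj (cinner (fst q) e) * cinner (snd p) (snd q)))"
      by (simp add: w_def cinner_sum_right cinner_scaleC_left cinner.ip_scale_right
          sum_distrib_left mult_ac)
    finally show "(\<Sum>p\<in>?P. \<Sum>q\<in>?P.
      Poly_Mapping.lookup f p * cnj (Poly_Mapping.lookup f q) * (cinner (fst p) e * cnj (cinner (fst q) e) * cinner (snd p) (snd q)))
      = cinner (w e) (w e)" by simp
  qed
  finally have "Re (tensor_form f f) = (\<Sum>e\<in>E. (norm (w e))\<^sup>2)"
    by (simp add: cinner_self)
  then show ?thesis by (simp add: sum_nonneg)
qed

global_interpretation tensor_form: semi_inner fscale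
  "tensor_form :: ('a::complex_inner \<times> 'b::complex_inner \<Rightarrow>\<^sub>0 complex) \<Rightarrow> _"
proof unfold_locales
  fix f g h :: "'a \<times> 'b \<Rightarrow>\<^sub>0 complex" and c :: complex
  let ?k = "\<lambda>p q. cinner (fst p) (fst q) * cinner (snd p) (snd q)"
  show "tensor_form g f = cnj (tensor_form f g)"
    unfolding tensor_form_def
    by (subst sum.swap) (simp add: mult_ac flip: cinner_commute)
  let ?P = "Poly_Mapping.keys f \<union> Poly_Mapping.keys g"
  have "tensor_form (f + g) h = (\<Sum>p\<in>?P. \<Sum>q\<in>Poly_Mapping.keys h. Poly_Mapping.lookup (f + g) p * cnj (Poly_Mapping.lookup h q) * ?k p q)"
    by (intro tensor_form_superset) (auto simp: keys_add)
  also have "\<dots> = (\<Sum>p\<in>?P. \<Sum>q\<in>Poly_Mapping.keys h. Poly_Mapping.lookup f p * cnj (Poly_Mapping.lookup h q) * ?k p q) +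
      (\<Sum>p\<in>?P. \<Sum>q\<in>Poly_Mapping.keys h. Poly_Mapping.lookup g p * cnj (Poly_Mapping.lookup h q) * ?k p q)"
    by (simp add: lookup_add algebra_simps sum.distrib)
  also have "\<dots> = tensor_form f h + tensor_form g h"
    by (intro arg_cong2[where f = "(+)"] tensor_form_superset[symmetric]) auto
  finally show "tensor_form (f + g) h = tensor_form f h + tensor_form g h" .
  have "tensor_form (fscale c f) g =
      (\<Sum>p\<in>Poly_Mapping.keys f. \<Sum>q\<in>Poly_Mapping.keys g. Poly_Mapping.lookup (fscale c f) p * cnj (Poly_Mapping.lookup g q) * ?k p q)"
    by (intro tensor_form_superset) (auto simp: keys_fscale)
  then show "tensor_form (fscale c f) g = c * tensor_form f g"
    by (simp add: tensor_form_def sum_distrib_left mult_ac)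
  show "0 \<le> Re (tensor_form f f)" by (rule tensor_form_nonneg)
qed

lemma tensor_form_single:
  "tensor_form (Poly_Mapping.single (a, b) 1) (Poly_Mapping.single (a', b') 1) = cinner a a' * cinner b b'"
  by (simp add: tensor_form_def)


subsection \<open>Completion\<close>

quotient_type (overloaded) ('a, 'b) htensor =
  "nat \<Rightarrow> ('a::complex_inner \<times> 'b::complex_inner \<Rightarrow>\<^sub>0 complex)" / partial: tensor_form.cauchy_equiv
  by (rule tensor_form.cauchy_equiv_part_equivp)

instantiation htensor :: (complex_inner, complex_inner) ab_group_add
begin

lift_definition zero_htensor :: "('a, 'b) htensor" is "\<lambda>_. 0"
  by (simp add: tensor_form.cauchy_equiv_refl tensor_form.cauchy_seq_const)

lift_definition plus_htensor :: "('a, 'b) htensor \<Rightarrow> ('a, 'b) htensor \<Rightarrow> ('a, 'b) htensor"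
  is "\<lambda>X Y n. X n + Y n"
  by (rule tensor_form.cauchy_equiv_add)

lift_definition uminus_htensor :: "('a, 'b) htensor \<Rightarrow> ('a, 'b) htensor"
  is "\<lambda>X n. - X n"
  by (rule tensor_form.cauchy_equiv_uminus)

definition minus_htensor :: "('a, 'b) htensor \<Rightarrow> ('a, 'b) htensor \<Rightarrow> ('a, 'b) htensor" where
  "minus_htensor x y = x + (- y)"

instance
proof
  fix x y z :: "('a, 'b) htensor"
  show "x + y + z = x + (y + z)"
    by transfer
       (simp add: add.assoc tensor_form.cauchy_equiv_def tensor_form.cauchy_seq_add)
  show "x + y = y + x"
    by transfer
       (simp add: add.commute tensor_form.cauchy_equiv_def tensor_form.cauchy_seq_add)
  show "0 + x = x"
    by transfer (simp add: tensor_form.cauchy_equiv_def)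
  show "- x + x = 0"
    by transfer (simp add: tensor_form.cauchy_equiv_def tensor_form.cauchy_seq_const)
  show "x - y = x + - y" by (rule minus_htensor_def)
qed

end

lift_definition htensor_scaleC :: "complex \<Rightarrow>
    ('a::complex_inner, 'b::complex_inner) htensor \<Rightarrow> ('a, 'b) htensor"
  is "\<lambda>c X n. fscale c (X n)"
  by (rule tensor_form.cauchy_equiv_scale)

lift_definition htensor_cinner ::
  "('a::complex_inner, 'b::complex_inner) htensor \<Rightarrow> ('a, 'b) htensor \<Rightarrow> complex"
  is "\<lambda>X Y. lim (\<lambda>n. tensor_form (X n) (Y n))"
  by (rule tensor_form.ip_lim_cong)

global_interpretation htensor: semi_inner htensor_scaleC
  "htensor_cinner :: ('a::complex_inner, 'b::complex_inner) htensor \<Rightarrow> _"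
proof unfold_locales
  note cs = tensor_form.cauchy_equiv_def tensor_form.cauchy_seq_add tensor_form.cauchy_seq_scale
  fix x y z :: "('a, 'b) htensor" and c d :: complex
  show "htensor_scaleC c (x + y) = htensor_scaleC c x + htensor_scaleC c y"
    by transfer (simp add: cs fscale.scale_right_distrib)
  show "htensor_scaleC (c + d) x = htensor_scaleC c x + htensor_scaleC d x"
    by transfer (simp add: cs fscale.scale_left_distrib)
  show "htensor_scaleC c (htensor_scaleC d x) = htensor_scaleC (c * d) x"
    by transfer (simp add: cs)
  show "htensor_scaleC 1 x = x"
    by transfer (simp add: cs)
  show "htensor_cinner y x = cnj (htensor_cinner x y)"
  proof transfer
    fix X Y :: "nat \<Rightarrow> 'a \<times> 'b \<Rightarrow>\<^sub>0 complex"
    assume "tensor_form.cauchy_equiv X X" "tensor_form.cauchy_equiv Y Y"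
    then have "(\<lambda>n. cnj (tensor_form (X n) (Y n))) \<longlonglongrightarrow> cnj (lim (\<lambda>n. tensor_form (X n) (Y n)))"
      by (intro tendsto_cnj tensor_form.ip_tendsto) (auto simp: cs)
    then show "lim (\<lambda>n. tensor_form (Y n) (X n)) = cnj (lim (\<lambda>n. tensor_form (X n) (Y n)))"
      by (simp add: limI flip: tensor_form.ip_commute)
  qed
  show "htensor_cinner (x + y) z = htensor_cinner x z + htensor_cinner y z"
  proof transfer
    fix X Y Z :: "nat \<Rightarrow> 'a \<times> 'b \<Rightarrow>\<^sub>0 complex"
    assume "tensor_form.cauchy_equiv X X" "tensor_form.cauchy_equiv Y Y"
      "tensor_form.cauchy_equiv Z Z"
    then show "lim (\<lambda>n. tensor_form (X n + Y n) (Z n)) =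
        lim (\<lambda>n. tensor_form (X n) (Z n)) + lim (\<lambda>n. tensor_form (Y n) (Z n))"
      unfolding tensor_form.ip_add_left
      by (intro limI tendsto_add tensor_form.ip_tendsto) (auto simp: cs)
  qed
  show "htensor_cinner (htensor_scaleC c x) y = c * htensor_cinner x y"
  proof transfer
    fix c and X Y :: "nat \<Rightarrow> 'a \<times> 'b \<Rightarrow>\<^sub>0 complex"
    assume "tensor_form.cauchy_equiv X X" "tensor_form.cauchy_equiv Y Y"
    then show "lim (\<lambda>n. tensor_form (fscale c (X n)) (Y n)) = c * lim (\<lambda>n. tensor_form (X n) (Y n))"
      unfolding tensor_form.ip_scale_left
      by (intro limI tendsto_mult_left tensor_form.ip_tendsto) (auto simp: cs)
  qed
  show "0 \<le> Re (htensor_cinner x x)"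
  proof transfer
    fix X :: "nat \<Rightarrow> 'a \<times> 'b \<Rightarrow>\<^sub>0 complex"
    assume "tensor_form.cauchy_equiv X X"
    then have "(\<lambda>n. Re (tensor_form (X n) (X n))) \<longlonglongrightarrow> Re (lim (\<lambda>n. tensor_form (X n) (X n)))"
      by (intro tendsto_Re tensor_form.ip_tendsto) (auto simp: cs)
    then show "0 \<le> Re (lim (\<lambda>n. tensor_form (X n) (X n)))"
      by (rule LIMSEQ_le_const) (auto simp: tensor_form_nonneg)
  qed
qed

lemma htensor_cinner_eq_0:
  assumes "htensor_cinner x x = 0"
  shows "x = 0"
  using assms
proof transfer
  fix X :: "nat \<Rightarrow> 'a \<times> 'b \<Rightarrow>\<^sub>0 complex"
  assume X: "tensor_form.cauchy_equiv X X" and lim0: "lim (\<lambda>n. tensor_form (X n) (X n)) = 0"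
  have "(\<lambda>n. tensor_form (X n) (X n)) \<longlonglongrightarrow> 0"
    using tensor_form.ip_tendsto[of X X] X lim0 by (simp add: tensor_form.cauchy_equiv_refl)
  then have "(\<lambda>n. sqrt (Re (tensor_form (X n) (X n)))) \<longlonglongrightarrow> sqrt (Re 0)"
    by (intro tendsto_real_sqrt tendsto_Re)
  then show "tensor_form.cauchy_equiv X (\<lambda>_. 0)"
    using X by (simp add: tensor_form.cauchy_equiv_def tensor_form.cauchy_seq_const tensor_form.snorm_def)
qed

instantiation htensor :: (complex_inner, complex_inner) real_normed_vector
begin

definition scaleR_htensor :: "real \<Rightarrow> ('a, 'b) htensor \<Rightarrow> ('a, 'b) htensor" where
  "scaleR_htensor r x = htensor_scaleC (complex_of_real r) x"

definition norm_htensor :: "('a, 'b) htensor \<Rightarrow> real" where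
  "norm_htensor x = sqrt (Re (htensor_cinner x x))"

definition sgn_htensor :: "('a, 'b) htensor \<Rightarrow> ('a, 'b) htensor" where
  "sgn_htensor x = inverse (norm x) *\<^sub>R x"

definition dist_htensor :: "('a, 'b) htensor \<Rightarrow> ('a, 'b) htensor \<Rightarrow> real" where
  "dist_htensor x y = norm (x - y)"

definition uniformity_htensor :: "(('a, 'b) htensor \<times> ('a, 'b) htensor) filter" where
  "uniformity_htensor = (INF e\<in>{0<..}. principal {(x, y). dist x y < e})"

definition open_htensor :: "('a, 'b) htensor set \<Rightarrow> bool" where
  "open_htensor U \<longleftrightarrow> (\<forall>x\<in>U. \<forall>\<^sub>F (x', y) in uniformity. x' = x \<longrightarrow> y \<in> U)"

instance
proof
  fix x y :: "('a, 'b) htensor" and a b :: real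
  show "a *\<^sub>R (x + y) = a *\<^sub>R x + a *\<^sub>R y" "(a + b) *\<^sub>R x = a *\<^sub>R x + b *\<^sub>R x"
    "a *\<^sub>R b *\<^sub>R x = (a * b) *\<^sub>R x" "1 *\<^sub>R x = x"
    by (simp_all add: scaleR_htensor_def htensor.scale_right_distrib htensor.scale_left_distrib)
  show "sgn x = inverse (norm x) *\<^sub>R x" by (rule sgn_htensor_def)
  show "dist x y = norm (x - y)" by (rule dist_htensor_def)
  show "(uniformity :: (('a, 'b) htensor \<times> ('a, 'b) htensor) filter) =
      (INF e\<in>{0<..}. principal {(x, y). dist x y < e})"
    by (rule uniformity_htensor_def)
  show "open U \<longleftrightarrow> (\<forall>x\<in>U. \<forall>\<^sub>F (x', y) in uniformity. x' = x \<longrightarrow> y \<in> U)"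
    for U :: "('a, 'b) htensor set"
    by (rule open_htensor_def)
  have norm_eq: "norm = (htensor.snorm :: ('a, 'b) htensor \<Rightarrow> real)"
    by (simp add: fun_eq_iff norm_htensor_def htensor.snorm_def)
  show "norm x = 0 \<longleftrightarrow> x = 0"
  proof
    assume "norm x = 0"
    then have "htensor_cinner x x = 0"
      using htensor.ip_self_real[of x] by (simp add: norm_htensor_def)
    then show "x = 0" by (rule htensor_cinner_eq_0)
  qed (simp add: norm_eq)
  show "norm (x + y) \<le> norm x + norm y"
    by (simp add: norm_eq htensor.snorm_triangle)
  show "norm (a *\<^sub>R x) = \<bar>a\<bar> * norm x"
    by (simp add: norm_eq scaleR_htensor_def htensor.snorm_scale)
qed

end

instantiation htensor :: (complex_inner, complex_inner) complex_inner
begin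

definition scaleC_htensor :: "complex \<Rightarrow> ('a, 'b) htensor \<Rightarrow> ('a, 'b) htensor" where
  "scaleC_htensor = htensor_scaleC"

definition cinner_htensor :: "('a, 'b) htensor \<Rightarrow> ('a, 'b) htensor \<Rightarrow> complex" where
  "cinner_htensor = htensor_cinner"

instance
proof
  fix x y z :: "('a, 'b) htensor" and r :: real and c d :: complex
  show "c *\<^sub>C (x + y) = c *\<^sub>C x + c *\<^sub>C y" "(c + d) *\<^sub>C x = c *\<^sub>C x + d *\<^sub>C x"
    "c *\<^sub>C d *\<^sub>C x = (c * d) *\<^sub>C x" "1 *\<^sub>C x = x"
    by (simp_all add: scaleC_htensor_def htensor.scale_right_distrib htensor.scale_left_distrib)
  show "complex_of_real r *\<^sub>C x = r *\<^sub>R x"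
    by (simp add: scaleC_htensor_def scaleR_htensor_def)
  show "cinner y x = cnj (cinner x y)"
    unfolding cinner_htensor_def by (rule htensor.ip_commute)
  show "cinner (x + y) z = cinner x z + cinner y z"
    unfolding cinner_htensor_def by (rule htensor.ip_add_left)
  show "cinner (c *\<^sub>C x) y = c * cinner x y"
    unfolding cinner_htensor_def scaleC_htensor_def by (rule htensor.ip_scale_left)
  show "cinner x x = complex_of_real ((norm x)\<^sup>2)"
    using htensor.ip_self_real[of x] htensor.ip_nonneg[of x]
    by (simp add: cinner_htensor_def norm_htensor_def)
qed

end

lifting_forget poly_mapping.lifting

lift_definition htensor_of ::
  "('a::complex_inner \<times> 'b::complex_inner \<Rightarrow>\<^sub>0 complex) \<Rightarrow> ('a, 'b) htensor" is "\<lambda>v _. v"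
  by (simp add: tensor_form.cauchy_equiv_refl tensor_form.cauchy_seq_const)

lemma htensor_of_add: "htensor_of (v + w) = htensor_of v + htensor_of w"
  by transfer (simp add: tensor_form.cauchy_equiv_refl tensor_form.cauchy_seq_const)

lemma htensor_of_diff: "htensor_of (v - w) = htensor_of v - htensor_of w"
  using htensor_of_add[of "v - w" w] by (simp add: algebra_simps)

lemma htensor_of_0: "htensor_of 0 = 0"
  using htensor_of_add[of 0 0] by simp

lemma htensor_of_fscale: "htensor_of (fscale c v) = c *\<^sub>C htensor_of v"
  unfolding scaleC_htensor_def
  by transfer (simp add: tensor_form.cauchy_equiv_refl tensor_form.cauchy_seq_const)

lemma cinner_htensor_of: "cinner (htensor_of v) (htensor_of w) = tensor_form v w"
  unfolding cinner_htensor_def by transfer simp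

lemma norm_htensor_of: "norm (htensor_of v) = tensor_form.snorm v"
  by (simp add: norm_htensor_def tensor_form.snorm_def flip: cinner_htensor_of cinner_htensor_def)

lemma htensor_of_tendsto_abs:
  fixes X :: "nat \<Rightarrow> 'a::complex_inner \<times> 'b::complex_inner \<Rightarrow>\<^sub>0 complex"
  assumes X: "tensor_form.cauchy_seq X"
  shows "(\<lambda>m. htensor_of (X m)) \<longlonglongrightarrow> abs_htensor X"
proof (rule LIMSEQ_I)
  fix e :: real assume "e > 0"
  then have "e / 2 > 0" by simp
  then obtain M where M: "\<forall>m\<ge>M. \<forall>n\<ge>M. tensor_form.snorm (X m - X n) < e / 2"
    using X unfolding tensor_form.cauchy_seq_def by blast
  have "norm (htensor_of (X m) - abs_htensor X) < e" if "m \<ge> M" for m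
  proof -
    define Y where "Y = (\<lambda>n. X m + - X n)"
    have Xe: "tensor_form.cauchy_equiv X X"
      using X by (simp add: tensor_form.cauchy_equiv_refl)
    have Xm: "tensor_form.cauchy_equiv (\<lambda>_. X m) (\<lambda>_. X m)"
      by (simp add: tensor_form.cauchy_equiv_refl tensor_form.cauchy_seq_const)
    have mXe: "tensor_form.cauchy_equiv (\<lambda>n. - X n) (\<lambda>n. - X n)"
      by (rule tensor_form.cauchy_equiv_uminus[OF Xe])
    have Y: "tensor_form.cauchy_equiv Y Y"
      unfolding Y_def by (rule tensor_form.cauchy_equiv_add[OF Xm mXe])
    have "htensor_of (X m) - abs_htensor X = abs_htensor Y"
      unfolding diff_conv_add_uminus htensor_of.abs_eq Y_def
      by (simp add: uminus_htensor.abs_eq[OF Xe] plus_htensor.abs_eq[OF Xm mXe])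
    then have "norm (htensor_of (X m) - abs_htensor X) = sqrt (Re (lim (\<lambda>n. tensor_form (Y n) (Y n))))"
      by (simp add: norm_htensor_def htensor_cinner.abs_eq[OF Y Y])
    moreover have "(\<lambda>n. tensor_form.snorm (Y n)) \<longlonglongrightarrow> sqrt (Re (lim (\<lambda>n. tensor_form (Y n) (Y n))))"
      unfolding tensor_form.snorm_def using Y
      by (intro tendsto_real_sqrt tendsto_Re tensor_form.ip_tendsto)
         (auto simp: tensor_form.cauchy_equiv_refl)
    ultimately have "(\<lambda>n. tensor_form.snorm (Y n)) \<longlonglongrightarrow> norm (htensor_of (X m) - abs_htensor X)"
      by simp
    moreover have "\<forall>n\<ge>M. tensor_form.snorm (Y n) \<le> e / 2"
      using M that by (auto simp: Y_def less_imp_le)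
    ultimately have "norm (htensor_of (X m) - abs_htensor X) \<le> e / 2"
      using LIMSEQ_le_const2 by blast
    with \<open>e > 0\<close> show ?thesis by simp
  qed
  then show "\<exists>M. \<forall>m\<ge>M. norm (htensor_of (X m) - abs_htensor X) < e" by blast
qed

lemma closure_range_htensor_of: "closure (range htensor_of) = UNIV"
proof -
  have "x \<in> closure (range htensor_of)" for x :: "('a::complex_inner, 'b::complex_inner) htensor"
  proof (induction x rule: htensor.abs_induct)
    case (1 X)
    then have "(\<lambda>m. htensor_of (X m)) \<longlonglongrightarrow> abs_htensor X"
      by (intro htensor_of_tendsto_abs) (simp add: tensor_form.cauchy_equiv_refl)
    then show ?case
      unfolding closure_sequential by (intro exI[of _ "\<lambda>m. htensor_of (X m)"]) simp
  qed
  then show ?thesis by blast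
qed

instance htensor :: (complex_inner, complex_inner) complex_hilbert_space
proof
  fix Z :: "nat \<Rightarrow> ('a, 'b) htensor"
  assume Z: "Cauchy Z"
  have "\<exists>v. dist (htensor_of v) (Z k) < 1 / real (Suc k)" for k
  proof -
    have "Z k \<in> closure (range htensor_of)" by (simp add: closure_range_htensor_of)
    then show ?thesis
      unfolding closure_approachable by (auto dest!: spec[of _ "1 / real (Suc k)"])
  qed
  then obtain v where v: "\<And>k. dist (htensor_of (v k)) (Z k) < 1 / real (Suc k)" by metis
  have "(\<lambda>k. dist (htensor_of (v k)) (Z k)) \<longlonglongrightarrow> 0"
    using v by (intro Lim_null_comparison[OF _ LIMSEQ_inverse_real_of_nat])
       (auto intro!: always_eventually simp: inverse_eq_divide less_imp_le)
  then have diff: "(\<lambda>k. htensor_of (v k) - Z k) \<longlonglongrightarrow> 0"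
    by (simp add: dist_norm tendsto_norm_zero_iff)
  have "Cauchy (\<lambda>k. htensor_of (v k))"
  proof (rule metric_CauchyI)
    fix e :: real assume "e > 0"
    then have e3: "e / 3 > 0" by simp
    obtain M where M: "\<And>m n. m \<ge> M \<Longrightarrow> n \<ge> M \<Longrightarrow> dist (Z m) (Z n) < e / 3"
      using metric_CauchyD[OF Z e3] by blast
    obtain N where N: "\<And>n. n \<ge> N \<Longrightarrow> dist (htensor_of (v n)) (Z n) < e / 3"
      using LIMSEQ_D[OF diff e3] by (auto simp: dist_norm)
    have "dist (htensor_of (v m)) (htensor_of (v n)) < e" if "m \<ge> max M N" "n \<ge> max M N" for m n
      using M[of m n] N[of m] N[of n] that
        dist_triangle[of "htensor_of (v m)" "htensor_of (v n)" "Z m"]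
        dist_triangle[of "Z m" "htensor_of (v n)" "Z n"] dist_commute[of "Z n" "htensor_of (v n)"]
      by simp
    then show "\<exists>M. \<forall>m\<ge>M. \<forall>n\<ge>M. dist (htensor_of (v m)) (htensor_of (v n)) < e" by blast
  qed
  then have "tensor_form.cauchy_seq v"
    by (simp add: Cauchy_def tensor_form.cauchy_seq_def dist_norm norm_htensor_of
        flip: htensor_of_diff)
  then have "(\<lambda>k. htensor_of (v k) - (htensor_of (v k) - Z k)) \<longlonglongrightarrow> abs_htensor v - 0"
    by (intro tendsto_diff htensor_of_tendsto_abs diff)
  then show "convergent Z" by (auto simp: convergent_def)
qed


subsection \<open>Elementary tensors and tensor products of operators\<close>

definition tensor :: "'a::complex_inner \<Rightarrow> 'b::complex_inner \<Rightarrow> ('a, 'b) htensor" where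
  "tensor a b = htensor_of (Poly_Mapping.single (a, b) 1)"

text \<open>
  The bounded operator \<open>S \<otimes> T\<close>; it is unique because elementary tensors span a dense subspace
  (\<open>closure_cspan_tensor\<close> below).
\<close>

definition tensor_op ::
  "('a::complex_inner \<Rightarrow> 'a) \<Rightarrow> ('b::complex_inner \<Rightarrow> 'b) \<Rightarrow> ('a, 'b) htensor \<Rightarrow> ('a, 'b) htensor" where
  "tensor_op S T = (THE R. bounded_clinear R \<and> (\<forall>a b. R (tensor a b) = tensor (S a) (T b)))"

lemma cinner_tensor: "cinner (tensor a b) (tensor a' b') = cinner a a' * cinner b b'"
  by (simp add: tensor_def cinner_htensor_of tensor_form_single)

lemma tensor_add_left: "tensor (a + a') b = tensor a b + tensor a' b"
proof -
  let ?D = "tensor (a + a') b - (tensor a b + tensor a' b)"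
  have "cinner ?D ?D = 0"
    by (simp only: cinner_tensor cinner_add_left cinner.ip_add_right cinner_scaleC_left
        cinner.ip_scale_right cinner.ip_diff_left cinner.ip_diff_right) (simp add: algebra_simps)
  then show ?thesis by (simp add: cinner_self)
qed

lemma tensor_add_right: "tensor a (b + b') = tensor a b + tensor a b'"
proof -
  let ?D = "tensor a (b + b') - (tensor a b + tensor a b')"
  have "cinner ?D ?D = 0"
    by (simp only: cinner_tensor cinner_add_left cinner.ip_add_right cinner_scaleC_left
        cinner.ip_scale_right cinner.ip_diff_left cinner.ip_diff_right) (simp add: algebra_simps)
  then show ?thesis by (simp add: cinner_self)
qed

lemma tensor_scaleC_left: "tensor (c *\<^sub>C a) b = c *\<^sub>C tensor a b"
proof -
  let ?D = "tensor (c *\<^sub>C a) b - c *\<^sub>C tensor a b"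
  have "cinner ?D ?D = 0"
    by (simp only: cinner_tensor cinner_add_left cinner.ip_add_right cinner_scaleC_left
        cinner.ip_scale_right cinner.ip_diff_left cinner.ip_diff_right) (simp add: algebra_simps)
  then show ?thesis by (simp add: cinner_self)
qed

lemma tensor_scaleC_right: "tensor a (c *\<^sub>C b) = c *\<^sub>C tensor a b"
proof -
  let ?D = "tensor a (c *\<^sub>C b) - c *\<^sub>C tensor a b"
  have "cinner ?D ?D = 0"
    by (simp only: cinner_tensor cinner_add_left cinner.ip_add_right cinner_scaleC_left
        cinner.ip_scale_right cinner.ip_diff_left cinner.ip_diff_right) (simp add: algebra_simps)
  then show ?thesis by (simp add: cinner_self)
qed

lemma htensor_of_in_cspan: "htensor_of v \<in> cspan {tensor a b |a b. True}"
proof -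
  have sum: "htensor_of (\<Sum>p\<in>P. f p) = (\<Sum>p\<in>P. htensor_of (f p))" for P :: "('a \<times> 'b) set" and f
    by (induction P rule: infinite_finite_induct) (auto simp: htensor_of_0 htensor_of_add)
  have v: "v = (\<Sum>p\<in>Poly_Mapping.keys v. fscale (Poly_Mapping.lookup v p) (Poly_Mapping.single p 1))"
    by (rule poly_mapping_eqI)
       (auto simp: lookup_sum lookup_single when_def in_keys_iff sum.delta if_distrib cong: if_cong)
  have "htensor_of v =
      (\<Sum>p\<in>Poly_Mapping.keys v. Poly_Mapping.lookup v p *\<^sub>C htensor_of (Poly_Mapping.single p 1))"
    by (subst v, unfold sum) (simp add: htensor_of_fscale)
  also have "\<dots> = (\<Sum>p\<in>Poly_Mapping.keys v. Poly_Mapping.lookup v p *\<^sub>C tensor (fst p) (snd p))"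
    by (simp add: tensor_def)
  also have "\<dots> \<in> cspan {tensor a b |a b. True}"
    by (intro complex_vector.span_sum complex_vector.span_scale complex_vector.span_base) blast
  finally show ?thesis .
qed

lemma closure_cspan_tensor: "closure (cspan {tensor a b |a b. True}) = UNIV"
proof -
  have "range htensor_of \<subseteq> cspan {tensor a b |a b. True}"
    using htensor_of_in_cspan by (rule image_subsetI)
  from closure_mono[OF this] show ?thesis
    by (simp add: closure_range_htensor_of top.extremum_unique)
qed

end

theory Submission
  imports Defs "HOL-Library.Function_Algebras"
begin

text \<open>
  Both claims are instances of one statement about commuting additive maps.  Write
  \<open>\<phi>\<^sub>S(X) = S\<^sup>* X S\<close> and \<open>\<phi>\<^sub>T(X) = T\<^sup>* X T\<close>; then the defect \<open>\<triangle>\<^sup>m\<close> of \<open>S\<close> is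
  \<open>(\<phi>\<^sub>S - 1)\<^sup>m(I)\<close>, and sandwiching an operator between \<open>S\<^sup>*\<^sup>n\<close> and \<open>S\<^sup>n\<close> is the application of
  \<open>\<phi>\<^sub>S\<^sup>n\<close> (\<open>defect_eq_funpow\<close>, \<open>sandwich_funpow\<close>).  If \<open>S\<close> and \<open>T\<close> commute, then so do
  \<open>\<phi>\<^sub>S\<close> and \<open>\<phi>\<^sub>T\<close>, the map belonging to \<open>ST\<close> is \<open>\<phi>\<^sub>S\<phi>\<^sub>T\<close>, and
  \<open>\<phi>\<^sub>S\<phi>\<^sub>T - 1 = \<phi>\<^sub>T(\<phi>\<^sub>S - 1) + (\<phi>\<^sub>T - 1)\<close>.
  In the expansion of the \<open>(m\<^sub>1 + m\<^sub>2 - 1)\<close>-th power every term contains either \<open>(\<phi>\<^sub>S - 1)\<close> at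
  least \<open>m\<^sub>1\<close> times or \<open>(\<phi>\<^sub>T - 1)\<close> at least \<open>m\<^sub>2\<close> times.  Applied to \<open>I\<close>, a term of the second
  kind vanishes since \<open>T\<close> is \<open>m\<^sub>2\<close>-isometric, and a term of the first kind is killed by the
  remaining \<open>(\<phi>\<^sub>S\<phi>\<^sub>T)\<^sup>n\<close> since \<open>S\<close> is \<open>n\<close>-quasi \<open>m\<^sub>1\<close>-isometric.  The algebra is
  \<open>commuting_defects\<close>, the conclusion for operators \<open>quasi_isometric_product\<close>.

  The tensor product claim reduces to commuting operators: \<open>S \<otimes> T\<close> is the product of \<open>S \<otimes> I\<close>
  and \<open>I \<otimes> T\<close>, which commute and inherit the hypotheses on \<open>S\<close> and \<open>T\<close>, because the defect
  of \<open>S \<otimes> I\<close> is the defect of \<open>S\<close> tensored with \<open>I\<close>.  This requires that adjoints exist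
  (\<open>adjoint_exists\<close>, from \<open>riesz_representation\<close>), that \<open>S \<otimes> T\<close> exists (\<open>tensor_op_exists\<close>,
  from a norm estimate on finite sums of elementary tensors), and that
  \<open>(S \<otimes> T)\<^sup>* = S\<^sup>* \<otimes> T\<^sup>*\<close> (\<open>adjoint_op_tensor_op\<close>).
\<close>

section \<open>Defects of commuting maps\<close>

lemma funpow_commute: "(\<And>x. f (g x) = g (f x)) \<Longrightarrow> (f ^^ k) (g x) = g ((f ^^ k) x)"
  by (induction k) simp_all

lemma funpow_comp_commute:
  assumes "\<And>x. f (g x) = g (f x)"
  shows "((\<lambda>x. f (g x)) ^^ k) x = (f ^^ k) ((g ^^ k) x)"
  by (induction k) (simp_all add: assms funpow_commute[of f g])

text \<open>
  The relations hold modulo a subgroup \<open>N\<close> that both maps preserve; in the application \<open>N\<close> is the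
  kernel of \<open>(\<phi>\<^sub>S\<phi>\<^sub>T)\<^sup>n\<close>, which encodes the word quasi.  Induction on \<open>a + b\<close> replaces the
  binomial expansion: with \<open>D = P - 1\<close>, \<open>E = R - 1\<close> and \<open>F = P R - 1 = R D + E\<close>, one step of \<open>F\<close>
  sends \<open>x\<close> to \<open>R (D x) + E x\<close>, whose first summand has spent one of the \<open>a\<close> powers of \<open>D\<close> and whose
  second summand has spent one of the \<open>b\<close> powers of \<open>E\<close>.
\<close>

lemma commuting_defects:
  fixes P R :: "'v::ab_group_add \<Rightarrow> 'v"
  assumes P: "Modules.additive P" and R: "Modules.additive R" and PR: "\<And>x. P (R x) = R (P x)"
    and N_0: "0 \<in> N" and N_add: "\<And>x y. x \<in> N \<Longrightarrow> y \<in> N \<Longrightarrow> x + y \<in> N"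
    and N_diff: "\<And>x y. x \<in> N \<Longrightarrow> y \<in> N \<Longrightarrow> x - y \<in> N"
    and N_P: "\<And>x. x \<in> N \<Longrightarrow> P x \<in> N" and N_R: "\<And>x. x \<in> N \<Longrightarrow> R x \<in> N"
    and a: "((\<lambda>x. P x - x) ^^ a) x \<in> N" and b: "((\<lambda>x. R x - x) ^^ b) x \<in> N"
  shows "((\<lambda>x. P (R x) - x) ^^ (a + b - 1)) x \<in> N"
proof -
  define D E F where "D = (\<lambda>x. P x - x)" and "E = (\<lambda>x. R x - x)" and "F = (\<lambda>x. P (R x) - x)"
  note defs = D_def E_def F_def
  note lin = Modules.additive.add[OF P] Modules.additive.add[OF R]
    Modules.additive.diff[OF P] Modules.additive.diff[OF R]
  have DE: "D (E x) = E (D x)" and DR: "D (R x) = R (D x)" and ER: "E (R x) = R (E x)" for x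
    by (simp_all add: defs lin PR)
  have F: "F x = R (D x) + E x" for x
    by (simp add: defs lin PR)
  have F_add: "(F ^^ k) (x + y) = (F ^^ k) x + (F ^^ k) y" for k x y
    by (induction k) (simp_all add: F_def lin)
  have N_F: "(F ^^ k) x \<in> N" if "x \<in> N" for k x
    by (induction k) (simp_all add: F_def that N_diff N_P N_R)
  have N_D: "D x \<in> N" and N_E: "E x \<in> N" if "x \<in> N" for x
    using that by (simp_all add: defs N_diff N_P N_R)
  have "(F ^^ (a + b - 1)) x \<in> N" if "(D ^^ a) x \<in> N" "(E ^^ b) x \<in> N"
    using that
  proof (induction "a + b" arbitrary: a b x rule: less_induct)
    case less
    show ?case
    proof (cases "a = 0 \<or> b = 0")
      case True
      \<comment> \<open>Here \<open>a + b - 1\<close> may be truncated, but every power of \<open>F\<close> maps \<open>N\<close> to itself.\<close>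
      then have "x \<in> N" using less.prems by auto
      then show ?thesis by (rule N_F)
    next
      case False
      then obtain a' b' where ab: "a = Suc a'" "b = Suc b'"
        by (metis not0_implies_Suc)
      have Da: "(D ^^ a') (D x) \<in> N" and Eb: "(E ^^ b') (E x) \<in> N"
        using less.prems by (simp_all add: ab funpow_swap1)
      have "(D ^^ a') (R (D x)) \<in> N"
        unfolding funpow_commute[of D R, OF DR] by (intro N_R Da)
      moreover have "(E ^^ b) (R (D x)) \<in> N"
        unfolding funpow_commute[of E R, OF ER] funpow_commute[of E D, OF DE[symmetric]]
        by (intro N_R N_D less.prems)
      ultimately have 1: "(F ^^ (a' + b - 1)) (R (D x)) \<in> N"
        by (intro less.hyps) (simp_all add: ab)
      have "(D ^^ a) (E x) \<in> N"
        unfolding funpow_commute[of D E, OF DE] by (intro N_E less.prems)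
      then have 2: "(F ^^ (a + b' - 1)) (E x) \<in> N"
        by (intro less.hyps) (simp_all add: ab Eb)
      have "(F ^^ (a + b - 1)) x = (F ^^ (a' + b')) (R (D x) + E x)"
        by (simp add: ab funpow_swap1 F)
      also have "\<dots> \<in> N"
        using 1 2 by (simp add: ab F_add N_add)
      finally show ?thesis .
    qed
  qed
  with a b show ?thesis by (simp add: defs)
qed

section \<open>The defect as an iterated difference\<close>

text \<open>
  The map \<open>\<phi>\<close>, defined on arbitrary functions: its additivity needs only that \<open>A\<close> is additive, so
  the pointwise group structure on the full function space suffices.
\<close>

definition sandwich :: "('a::ab_group_add \<Rightarrow> 'a) \<Rightarrow> ('a \<Rightarrow> 'a) \<Rightarrow> ('a \<Rightarrow> 'a) \<Rightarrow> 'a \<Rightarrow> 'a" where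
  "sandwich A B X = A \<circ> X \<circ> B"

lemma additive_sandwich: "Modules.additive A \<Longrightarrow> Modules.additive (sandwich A B)"
  by (rule Modules.additive.intro) (simp add: sandwich_def fun_eq_iff Modules.additive.add)

lemma sandwich_funpow: "(sandwich A B ^^ k) X = (A ^^ k) \<circ> X \<circ> (B ^^ k)"
  by (induction k) (simp_all add: sandwich_def fun_eq_iff funpow_swap1)

lemma additive_funpow:
  fixes A :: "'a::ab_group_add \<Rightarrow> 'a"
  shows "Modules.additive A \<Longrightarrow> Modules.additive (A ^^ k)"
  by (induction k) (simp_all add: Modules.additive_def)

text \<open>
  The binomial formula for \<open>(\<phi> - 1)\<^sup>m\<close>.  With \<open>a\<^sub>i = A\<^sup>i X B\<^sup>i\<close> the step replaces \<open>X\<close> by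
  \<open>\<phi> X - X\<close>, hence \<open>a\<^sub>i\<close> by \<open>a\<^sub>i\<^sub>+\<^sub>1 - a\<^sub>i\<close>, and Pascal's rule recombines the coefficients.
\<close>

lemma sandwich_difference_funpow:
  fixes A B X :: "'a::complex_inner \<Rightarrow> 'a"
  assumes A: "Modules.additive A"
  shows "((\<lambda>X. sandwich A B X - X) ^^ m) X x =
    (\<Sum>j=0..m. ((-1) ^ j * of_nat (m choose j)) *\<^sub>C (A ^^ (m - j)) (X ((B ^^ (m - j)) x)))"
proof (induction m arbitrary: X)
  case 0
  show ?case by (simp add: scaleC_one)
next
  case (Suc m)
  define a where "a i = (A ^^ i) (X ((B ^^ i) x))" for i
  define c where "c m j = ((-1) ^ j * of_nat (m choose j) :: complex)" for m j
  have shift: "(A ^^ i) ((sandwich A B X - X) ((B ^^ i) x)) = a (Suc i) - a i" for i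
    by (simp add: sandwich_def a_def Modules.additive.diff[OF additive_funpow[OF A]] funpow_swap1)
  have c_Suc: "c (Suc m) (Suc j) = c m (Suc j) - c m j" for j
    by (simp add: c_def algebra_simps)
  have last: "c m (Suc m) = 0" and first: "c m 0 = c (Suc m) 0"
    by (simp_all add: c_def)
  have "((\<lambda>X. sandwich A B X - X) ^^ Suc m) X x =
      (\<Sum>j=0..m. c m j *\<^sub>C (a (Suc (m - j)) - a (m - j)))"
    by (simp only: funpow_Suc_right o_apply Suc.IH shift c_def)
  also have "\<dots> = (\<Sum>j=0..m. c m j *\<^sub>C a (Suc m - j)) - (\<Sum>j=0..m. c m j *\<^sub>C a (m - j))"
    unfolding sum_subtractf[symmetric]
    by (intro sum.cong refl) (simp add: complex_vector.scale_right_diff_distrib Suc_diff_le)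
  also have "(\<Sum>j=0..m. c m j *\<^sub>C a (Suc m - j)) = (\<Sum>j=0..Suc m. c m j *\<^sub>C a (Suc m - j))"
    by (simp add: last)
  also have "\<dots> = c (Suc m) 0 *\<^sub>C a (Suc m) + (\<Sum>j=0..m. c m (Suc j) *\<^sub>C a (m - j))"
    by (subst sum.atLeast0_atMost_Suc_shift) (simp add: first)
  also have "\<dots> - (\<Sum>j=0..m. c m j *\<^sub>C a (m - j)) =
      c (Suc m) 0 *\<^sub>C a (Suc m) + (\<Sum>j=0..m. c (Suc m) (Suc j) *\<^sub>C a (m - j))"
    by (simp add: c_Suc complex_vector.scale_left_diff_distrib sum_subtractf)
  also have "\<dots> = (\<Sum>j=0..Suc m. c (Suc m) j *\<^sub>C a (Suc m - j))"
    by (subst sum.atLeast0_atMost_Suc_shift) simp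
  finally show ?case by (simp only: c_def a_def)
qed

lemma defect_eq_funpow:
  assumes "Modules.additive A"
  shows "defect m A B = ((\<lambda>X. sandwich A B X - X) ^^ m) id"
  by (simp add: fun_eq_iff defect_def sandwich_difference_funpow[OF assms])

section \<open>Bounded operators and their adjoints\<close>

lemma bounded_clinearD:
  assumes "bounded_clinear A"
  shows "bounded_linear A" "A (c *\<^sub>C x) = c *\<^sub>C A x"
  using assms by (auto simp: bounded_clinear_def)

lemma bounded_clinear_additive: "bounded_clinear A \<Longrightarrow> Modules.additive A"
  by (simp add: Modules.additive_def bounded_clinearD(1) linear_add bounded_linear.linear)

lemma bounded_clinear_id: "bounded_clinear id"
  by (simp add: bounded_clinear_def id_def)

lemma bounded_clinear_comp:
  "bounded_clinear A \<Longrightarrow> bounded_clinear B \<Longrightarrow> bounded_clinear (A \<circ> B)"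
  unfolding bounded_clinear_def o_def by (auto intro: bounded_linear_compose)

lemma bounded_clinear_intro:
  assumes add: "\<And>x y. A (x + y) = A x + A y" and scale: "\<And>c x. A (c *\<^sub>C x) = c *\<^sub>C A x"
    and bound: "\<And>x. norm (A x) \<le> norm x * K"
  shows "bounded_clinear A"
proof -
  have "A (r *\<^sub>R x) = r *\<^sub>R A x" for r x
    by (simp add: scale flip: scaleC_of_real)
  then have "bounded_linear A"
    using add bound by (intro bounded_linear_intro)
  with scale show ?thesis by (simp add: bounded_clinear_def)
qed

lemma power2_norm_add:
  fixes x y :: "'a::complex_inner"
  shows "(norm (x + y))\<^sup>2 = (norm x)\<^sup>2 + (norm y)\<^sup>2 + 2 * Re (cinner x y)"
proof -
  have "Re (cinner y x) = Re (cinner x y)"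
    by (subst cinner_commute) simp
  then show ?thesis
    by (simp add: cinner.snorm_sq cinner_add_left cinner.ip_add_right)
qed

lemma parallelogram_law:
  fixes x y :: "'a::complex_inner"
  shows "(norm (x + y))\<^sup>2 + (norm (x - y))\<^sup>2 = 2 * (norm x)\<^sup>2 + 2 * (norm y)\<^sup>2"
  using power2_norm_add[of x y] power2_norm_add[of x "- y"]
  by (simp add: cinner.ip_uminus_right)

lemma cinner_eqI:
  fixes y z :: "'a::complex_inner"
  assumes "\<And>x. cinner x y = cinner x z"
  shows "y = z"
proof -
  have "cinner (y - z) (y - z) = 0"
    by (simp add: cinner.ip_diff_right assms)
  then show ?thesis by (simp add: cinner_self)
qed

text \<open>
  The representing vector is the minimizer \<open>p\<close> of \<open>J x = \<parallel>x\<parallel>\<^sup>2 - 2 Re (f x)\<close>, which equals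
  \<open>\<parallel>x - p\<parallel>\<^sup>2 - \<parallel>p\<parallel>\<^sup>2\<close> once \<open>p\<close> is known to represent \<open>f\<close>.  The parallelogram law makes every
  minimizing sequence Cauchy, completeness supplies the minimizer, and the first variation of \<open>J\<close> at \<open>p\<close>
  is the real part of the claim.
\<close>

lemma riesz_representation:
  fixes f :: "'a::complex_hilbert_space \<Rightarrow> complex"
  assumes f: "bounded_linear f" and f_scaleC: "\<And>c x. f (c *\<^sub>C x) = c * f x"
  shows "\<exists>p. \<forall>x. f x = cinner x p"
proof -
  interpret f: bounded_linear f by (rule f)
  define J where "J x = (norm x)\<^sup>2 - 2 * Re (f x)" for x
  obtain K where K: "\<And>x. norm (f x) \<le> norm x * K"
    using f.bounded by blast
  have "- K\<^sup>2 \<le> J x" for x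
  proof -
    have "Re (f x) \<le> norm x * K"
      using K[of x] complex_Re_le_cmod[of "f x"] by linarith
    moreover have "0 \<le> (norm x - K)\<^sup>2" by simp
    ultimately show ?thesis by (simp add: J_def power2_diff)
  qed
  then have bdd: "bdd_below (range J)" by (intro bdd_belowI2)
  define d where "d = Inf (range J)"
  have d_le: "d \<le> J x" for x
    unfolding d_def by (rule cInf_lower[OF _ bdd]) simp
  have "\<exists>x. J x < d + inverse (real (Suc k))" for k
    using cInf_lessD[of "range J" "d + inverse (real (Suc k))"] by (auto simp: d_def)
  then obtain X where X: "\<And>k. J (X k) < d + inverse (real (Suc k))" by metis
  have dist_sq: "(norm (x - y))\<^sup>2 \<le> 2 * (J x - d) + 2 * (J y - d)" for x y
  proof -
    have "J ((1 / 2) *\<^sub>R (x + y)) = (norm (x + y))\<^sup>2 / 4 - Re (f x) - Re (f y)"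
      by (simp add: J_def f.scaleR f.add power_mult_distrib power_divide
          add_divide_distrib)
    with d_le[of "(1 / 2) *\<^sub>R (x + y)"] parallelogram_law[of x y] show ?thesis
      by (simp add: J_def)
  qed
  have "Cauchy X"
  proof (rule metric_CauchyI)
    fix e :: real assume "e > 0"
    then obtain M where M: "inverse (real (Suc M)) < e\<^sup>2 / 4"
      using reals_Archimedean[of "e\<^sup>2 / 4"] by auto
    have "dist (X i) (X j) < e" if "i \<ge> M" "j \<ge> M" for i j
    proof -
      have "inverse (real (Suc i)) \<le> inverse (real (Suc M))"
        "inverse (real (Suc j)) \<le> inverse (real (Suc M))"
        using that by (auto intro!: le_imp_inverse_le)
      with M X[of i] X[of j] dist_sq[of "X i" "X j"] have "(norm (X i - X j))\<^sup>2 < e\<^sup>2"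
        by argo
      then show ?thesis
        using \<open>e > 0\<close> by (simp add: dist_norm power2_less_imp_less)
    qed
    then show "\<exists>M. \<forall>i\<ge>M. \<forall>j\<ge>M. dist (X i) (X j) < e" by blast
  qed
  then obtain p where p: "X \<longlonglongrightarrow> p"
    using Cauchy_convergent convergent_def by blast
  have "(\<lambda>k. J (X k)) \<longlonglongrightarrow> J p"
    unfolding J_def by (intro tendsto_intros f.tendsto p)
  moreover have "(\<lambda>k. d + inverse (real (Suc k))) \<longlonglongrightarrow> d + 0"
    by (intro tendsto_intros LIMSEQ_inverse_real_of_nat)
  ultimately have "J p \<le> d"
    using X LIMSEQ_le[of "\<lambda>k. J (X k)" "J p" "\<lambda>k. d + inverse (real (Suc k))" d]
    by (auto simp: less_imp_le)
  then have J_min: "J p \<le> J x" for x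
    using d_le[of x] by linarith
  have Re_eq: "Re (f v) = Re (cinner v p)" for v
  proof -
    define c where "c = Re (cinner p v) - Re (f v)"
    define N where "N = (norm v)\<^sup>2 + 1"
    have N: "N > 0" "(norm v)\<^sup>2 = N - 1" by (simp_all add: N_def add_nonneg_pos)
    have quad: "0 \<le> t\<^sup>2 * (norm v)\<^sup>2 + 2 * t * c" for t :: real
    proof -
      have "cinner p (t *\<^sub>R v) = t * cinner p v"
        by (simp add: cinner.ip_scale_right flip: scaleC_of_real)
      then have "J (p + t *\<^sub>R v) = J p + t\<^sup>2 * (norm v)\<^sup>2 + 2 * t * c"
        by (simp add: J_def c_def power2_norm_add f.add f.scaleR power_mult_distrib algebra_simps)
      with J_min[of "p + t *\<^sub>R v"] show ?thesis by linarith
    qed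
    \<comment> \<open>A nonzero slope \<open>c\<close> would make the quadratic negative at \<open>t = - c / N\<close>; the summand 1 in \<open>N\<close>
      covers \<open>v = 0\<close>.\<close>
    have "0 \<le> (- c / N)\<^sup>2 * (N - 1) + 2 * (- c / N) * c"
      using quad[of "- c / N"] by (simp add: N(2))
    also have "\<dots> = - (c\<^sup>2 * (N + 1) / N\<^sup>2)"
      using N(1) by (simp add: field_simps power2_eq_square)
    finally have "c\<^sup>2 * (N + 1) / N\<^sup>2 \<le> 0" by simp
    then have "c = 0"
      using N(1) by (simp add: divide_le_0_iff mult_le_0_iff power_le_zero_eq)
    moreover have "Re (cinner p v) = Re (cinner v p)"
      by (subst cinner_commute) simp
    ultimately show ?thesis by (simp add: c_def)
  qed
  \<comment> \<open>Complex linearity turns the real part at \<open>\<i> v\<close> into the imaginary part at \<open>v\<close>.\<close>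
  have "f v = cinner v p" for v
    using Re_eq[of v] Re_eq[of "\<i> *\<^sub>C v"]
    by (simp add: complex_eq_iff f_scaleC cinner_scaleC_left)
  then show ?thesis by blast
qed

lemma adjoint_exists:
  fixes A :: "'a::complex_hilbert_space \<Rightarrow> 'a"
  assumes A: "bounded_clinear A"
  shows "\<exists>B. bounded_clinear B \<and> (\<forall>x y. cinner (A x) y = cinner x (B y))"
proof -
  interpret A: bounded_linear A by (rule bounded_clinearD[OF A])
  obtain K where K: "0 \<le> K" "\<And>x. norm (A x) \<le> norm x * K"
    using A.nonneg_bounded by blast
  have "\<exists>p. \<forall>x. cinner (A x) y = cinner x p" for y
  proof (rule riesz_representation)
    show "bounded_linear (\<lambda>x. cinner (A x) y)"
    proof (rule bounded_linear_intro)
      show "cinner (A (r *\<^sub>R x)) y = r *\<^sub>R cinner (A x) y" for r x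
        by (simp add: bounded_clinearD(2)[OF A] cinner_scaleC_left scaleR_conv_of_real
            flip: scaleC_of_real)
      show "norm (cinner (A x) y) \<le> norm x * (K * norm y)" for x
        using cinner.Cauchy_Schwarz[of "A x" y] mult_right_mono[OF K(2)[of x], of "norm y"]
        by (simp add: mult.assoc)
    qed (simp add: A.add cinner_add_left)
  qed (simp add: bounded_clinearD[OF A] cinner_scaleC_left)
  then obtain B where B: "\<And>x y. cinner (A x) y = cinner x (B y)" by metis
  have "bounded_clinear B"
  proof (rule bounded_clinear_intro)
    show "B (x + y) = B x + B y" for x y
      by (rule cinner_eqI) (simp add: cinner.ip_add_right flip: B)
    show "B (c *\<^sub>C x) = c *\<^sub>C B x" for c x
      by (rule cinner_eqI) (simp add: cinner.ip_scale_right flip: B)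
    show "norm (B y) \<le> norm y * K" for y
    proof (cases "B y = 0")
      case False
      have "(norm (B y))\<^sup>2 = norm (cinner (A (B y)) y)"
        by (simp add: B cinner_self norm_power)
      also have "\<dots> \<le> norm (B y) * K * norm y"
        using cinner.Cauchy_Schwarz[of "A (B y)" y] mult_right_mono[OF K(2)[of "B y"], of "norm y"]
        by simp
      finally show ?thesis
        using False by (simp add: power2_eq_square mult_ac)
    qed (simp add: K)
  qed
  with B show ?thesis by blast
qed

lemma adjoint_op_eqI:
  assumes "bounded_clinear B" and "\<And>x y. cinner (A x) y = cinner x (B y)"
  shows "adjoint_op A = B"
  unfolding adjoint_op_def
proof (rule the_equality)
  fix B' assume "bounded_clinear B' \<and> (\<forall>x y. cinner (A x) y = cinner x (B' y))"
  then show "B' = B"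
    using assms(2) by (intro ext cinner_eqI) metis
qed (use assms in blast)

lemma
  fixes A :: "'a::complex_hilbert_space \<Rightarrow> 'a"
  assumes "bounded_clinear A"
  shows bounded_clinear_adjoint_op: "bounded_clinear (adjoint_op A)"
    and cinner_adjoint_op: "cinner x (adjoint_op A y) = cinner (A x) y"
  using adjoint_exists[OF assms] adjoint_op_eqI[of _ A] by metis+

lemma adjoint_op_id: "adjoint_op id = id"
  by (rule adjoint_op_eqI) (simp_all add: bounded_clinear_id)

lemma adjoint_op_comp:
  fixes A B :: "'a::complex_hilbert_space \<Rightarrow> 'a"
  assumes "bounded_clinear A" "bounded_clinear B"
  shows "adjoint_op (A \<circ> B) = adjoint_op B \<circ> adjoint_op A"
  by (rule adjoint_op_eqI)
     (simp_all add: assms cinner_adjoint_op bounded_clinear_comp bounded_clinear_adjoint_op)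

section \<open>Products of commuting operators\<close>

text \<open>
  The subgroup for \<open>commuting_defects\<close> is the kernel of \<open>Q = (\<phi>\<^sub>S\<phi>\<^sub>T)\<^sup>n = \<phi>\<^sub>T\<^sup>n \<phi>\<^sub>S\<^sup>n\<close>.  It contains
  the \<open>m1\<close>-th defect of \<open>S\<close>, which \<open>\<phi>\<^sub>S\<^sup>n\<close> already annihilates, and the \<open>m2\<close>-th defect of
  \<open>T\<close>, which is zero.
\<close>

theorem quasi_isometric_product:
  fixes S T :: "'a::complex_hilbert_space \<Rightarrow> 'a"
  assumes S: "bounded_clinear S" and T: "bounded_clinear T" and ST: "S \<circ> T = T \<circ> S"
    and S_quasi: "(adjoint_op S ^^ n) \<circ> defect m1 (adjoint_op S) S \<circ> (S ^^ n) = (\<lambda>_. 0)"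
    and T_isom: "defect m2 (adjoint_op T) T = (\<lambda>_. 0)"
  shows "(adjoint_op (S \<circ> T) ^^ n) \<circ>
    defect (m1 + m2 - 1) (adjoint_op S \<circ> adjoint_op T) (S \<circ> T) \<circ> ((S \<circ> T) ^^ n) = (\<lambda>_. 0)"
proof -
  define P R where "P = sandwich (adjoint_op S) S" and "R = sandwich (adjoint_op T) T"
  define Q where "Q = (sandwich (adjoint_op S \<circ> adjoint_op T) (S \<circ> T) ^^ n)"
  note adj_add = bounded_clinear_additive[OF bounded_clinear_adjoint_op]
  have adj_ST: "adjoint_op S \<circ> adjoint_op T = adjoint_op (S \<circ> T)"
    using adjoint_op_comp[OF T S] by (simp add: ST)
  have adj_comm: "adjoint_op S \<circ> adjoint_op T = adjoint_op T \<circ> adjoint_op S"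
    using adj_ST adjoint_op_comp[OF S T] by simp
  have PR: "P (R X) = sandwich (adjoint_op S \<circ> adjoint_op T) (S \<circ> T) X" for X
    using ST by (simp add: P_def R_def sandwich_def comp_assoc)
  have RP: "R (P X) = sandwich (adjoint_op S \<circ> adjoint_op T) (S \<circ> T) X" for X
    unfolding adj_comm by (simp add: P_def R_def sandwich_def comp_assoc)
  have P: "Modules.additive P" and R: "Modules.additive R"
    unfolding P_def R_def by (intro additive_sandwich adj_add S T)+
  have Q: "Modules.additive Q"
    unfolding Q_def adj_ST
    by (intro additive_funpow additive_sandwich adj_add bounded_clinear_comp S T)
  have Q_P: "Q (P X) = P (Q X)" and Q_R: "Q (R X) = R (Q X)" for X
    unfolding Q_def by (rule funpow_commute; metis PR RP)+
  have Q_PR: "Q X = (R ^^ n) ((P ^^ n) X)" for X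
    using funpow_comp_commute[of R P n X] by (simp add: Q_def PR RP)
  have "((\<lambda>X. P (R X) - X) ^^ (m1 + m2 - 1)) id \<in> {X. Q X = 0}"
  proof (rule commuting_defects[OF P R])
    have "(P ^^ n) (((\<lambda>X. P X - X) ^^ m1) id) = 0"
      using S_quasi unfolding P_def sandwich_funpow defect_eq_funpow[OF adj_add[OF S]]
      by (simp add: zero_fun_def)
    then show "((\<lambda>X. P X - X) ^^ m1) id \<in> {X. Q X = 0}"
      by (simp add: Q_PR Modules.additive.zero[OF additive_funpow[OF R]])
    have "((\<lambda>X. R X - X) ^^ m2) id = 0"
      using T_isom unfolding R_def defect_eq_funpow[OF adj_add[OF T]]
      by (simp add: zero_fun_def)
    then show "((\<lambda>X. R X - X) ^^ m2) id \<in> {X. Q X = 0}"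
      by (simp add: Modules.additive.zero[OF Q])
  qed (simp_all add: PR RP Q_P Q_R Modules.additive.zero[OF P] Modules.additive.zero[OF R] Modules.additive.zero[OF Q]
      Modules.additive.add[OF Q] Modules.additive.diff[OF Q])
  then show ?thesis
    unfolding PR mem_Collect_eq Q_def sandwich_funpow adj_ST
    by (subst defect_eq_funpow)
       (simp_all add: zero_fun_def adj_add bounded_clinear_comp S T)
qed

section \<open>Gram sums and the tensor product of operators\<close>

text \<open>
  By \<open>norm_tensor_sum\<close> below, the left-hand side is the squared norm of \<open>\<Sum>p. a p \<otimes> b p\<close>.  The
  assumption on \<open>E\<close> rewrites this tensor as \<open>\<Sum>e. w e \<otimes> e\<close> with \<open>w e = \<Sum>p. \<langle>b p, e\<rangle> a p\<close>, and it
  gives a Parseval identity for the \<open>b p\<close>, so that the squared norm is the sum of the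
  \<open>\<parallel>w e\<parallel>\<^sup>2\<close>, as if the summands were orthogonal.
\<close>

lemma gram_sum_eq:
  fixes a :: "'p \<Rightarrow> 'a::complex_inner" and b :: "'p \<Rightarrow> 'b::complex_inner"
  assumes E: "\<And>p. p \<in> P \<Longrightarrow> b p = (\<Sum>e\<in>E. cinner (b p) e *\<^sub>C e)"
  shows "(\<Sum>p\<in>P. \<Sum>q\<in>P. cinner (a p) (a q) * cinner (b p) (b q)) =
    of_real (\<Sum>e\<in>E. (norm (\<Sum>p\<in>P. cinner (b p) e *\<^sub>C a p))\<^sup>2)"
proof -
  have parseval: "cinner (b p) (b q) = (\<Sum>e\<in>E. cinner (b p) e * cnj (cinner (b q) e))"
    if "p \<in> P" for p q
  proof -
    have "cinner (b p) (b q) = cinner (\<Sum>e\<in>E. cinner (b p) e *\<^sub>C e) (b q)"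
      by (subst E[OF that]) (rule refl)
    then show ?thesis
      by (simp add: cinner_sum_left cinner_scaleC_left flip: cinner_commute)
  qed
  have "(\<Sum>p\<in>P. \<Sum>q\<in>P. cinner (a p) (a q) * cinner (b p) (b q)) =
      (\<Sum>p\<in>P. \<Sum>q\<in>P. \<Sum>e\<in>E. cinner (b p) e * (cnj (cinner (b q) e) * cinner (a p) (a q)))"
    by (intro sum.cong refl) (simp add: parseval sum_distrib_left mult_ac)
  also have "\<dots> = (\<Sum>p\<in>P. \<Sum>e\<in>E. \<Sum>q\<in>P. cinner (b p) e * (cnj (cinner (b q) e) * cinner (a p) (a q)))"
    by (intro sum.cong refl sum.swap)
  also have "\<dots> = (\<Sum>e\<in>E. \<Sum>p\<in>P. \<Sum>q\<in>P. cinner (b p) e * (cnj (cinner (b q) e) * cinner (a p) (a q)))"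
    by (rule sum.swap)
  also have "\<dots> = (\<Sum>e\<in>E. cinner (\<Sum>p\<in>P. cinner (b p) e *\<^sub>C a p) (\<Sum>p\<in>P. cinner (b p) e *\<^sub>C a p))"
    unfolding cinner_sum_left unfolding cinner_sum_right
    by (simp add: cinner_scaleC_left cinner.ip_scale_right mult_ac)
  also have "\<dots> = of_real (\<Sum>e\<in>E. (norm (\<Sum>p\<in>P. cinner (b p) e *\<^sub>C a p))\<^sup>2)"
    by (simp add: cinner_self)
  finally show ?thesis .
qed

text \<open>
  An operator on the first factor acts on each \<open>w e = \<Sum>p. \<langle>b p, e\<rangle> a p\<close> of \<open>gram_sum_eq\<close>
  separately, so its norm bounds the result.  The double sum is symmetric in its two factors, hence the same estimate
  serves an operator on the second factor.
\<close>

lemma gram_sum_bound: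
  fixes a :: "'p \<Rightarrow> 'a::complex_inner" and b :: "'p \<Rightarrow> 'b::complex_inner"
  assumes S: "bounded_clinear S" and K: "0 \<le> K" "\<And>x. norm (S x) \<le> norm x * K" and P: "finite P"
  shows "Re (\<Sum>p\<in>P. \<Sum>q\<in>P. cinner (S (a p)) (S (a q)) * cinner (b p) (b q)) \<le>
    Re (\<Sum>p\<in>P. \<Sum>q\<in>P. cinner (a p) (a q) * cinner (b p) (b q)) * K\<^sup>2"
proof -
  interpret S: bounded_linear S by (rule bounded_clinearD[OF S])
  obtain E where "\<And>x. x \<in> b ` P \<Longrightarrow> x = (\<Sum>e\<in>E. cinner x e *\<^sub>C e)"
    using orthonormal_expansion_exists[of "b ` P"] P by auto
  then have E: "b p = (\<Sum>e\<in>E. cinner (b p) e *\<^sub>C e)" if "p \<in> P" for p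
    using that by blast
  define w where "w e = (\<Sum>p\<in>P. cinner (b p) e *\<^sub>C a p)" for e
  have Sw: "(\<Sum>p\<in>P. cinner (b p) e *\<^sub>C S (a p)) = S (w e)" for e
    by (simp add: w_def S.sum bounded_clinearD(2)[OF S])
  have "(norm (S (w e)))\<^sup>2 \<le> (norm (w e))\<^sup>2 * K\<^sup>2" for e
    using power_mono[OF K(2)[of "w e"], of 2] by (simp add: power_mult_distrib)
  then have "(\<Sum>e\<in>E. (norm (S (w e)))\<^sup>2) \<le> (\<Sum>e\<in>E. (norm (w e))\<^sup>2) * K\<^sup>2"
    unfolding sum_distrib_right by (rule sum_mono)
  then show ?thesis
    by (simp only: gram_sum_eq[OF E] Re_complex_of_real Sw flip: w_def)
qed

lemma norm_tensor_sum:
  "(norm (\<Sum>p\<in>P. tensor (a p) (b p)))\<^sup>2 =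
    Re (\<Sum>p\<in>P. \<Sum>q\<in>P. cinner (a p) (a q) * cinner (b p) (b q))"
  unfolding cinner.snorm_sq cinner_sum_left unfolding cinner_sum_right cinner_tensor ..

lemma norm_tensor_sum_map:
  fixes S :: "'a::complex_inner \<Rightarrow> 'a" and T :: "'b::complex_inner \<Rightarrow> 'b"
  assumes S: "bounded_clinear S" and K: "0 \<le> K" "\<And>x. norm (S x) \<le> norm x * K"
    and T: "bounded_clinear T" and L: "0 \<le> L" "\<And>x. norm (T x) \<le> norm x * L"
    and P: "finite P"
  shows "norm (\<Sum>p\<in>P. tensor (S (a p)) (T (b p))) \<le> norm (\<Sum>p\<in>P. tensor (a p) (b p)) * (K * L)"
proof (rule power2_le_imp_le)
  have "(norm (\<Sum>p\<in>P. tensor (S (a p)) (T (b p))))\<^sup>2 \<le>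
      (norm (\<Sum>p\<in>P. tensor (a p) (T (b p))))\<^sup>2 * K\<^sup>2"
    unfolding norm_tensor_sum by (rule gram_sum_bound[OF S K P])
  also have "(norm (\<Sum>p\<in>P. tensor (a p) (T (b p))))\<^sup>2 \<le>
      (norm (\<Sum>p\<in>P. tensor (a p) (b p)))\<^sup>2 * L\<^sup>2"
    using gram_sum_bound[OF T L P, of b a] unfolding norm_tensor_sum by (simp add: mult.commute)
  finally show "(norm (\<Sum>p\<in>P. tensor (S (a p)) (T (b p))))\<^sup>2 \<le>
      (norm (\<Sum>p\<in>P. tensor (a p) (b p)) * (K * L))\<^sup>2"
    by (simp add: power_mult_distrib mult_ac mult_right_mono)
qed (simp add: K L)

lemma htensor_of_eq_sum:
  "htensor_of v = (\<Sum>p\<in>Poly_Mapping.keys v. tensor (Poly_Mapping.lookup v p *\<^sub>C fst p) (snd p))"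
proof -
  have sum: "htensor_of (\<Sum>p\<in>P. f p) = (\<Sum>p\<in>P. htensor_of (f p))"
    for P :: "('a \<times> 'b) set" and f :: "_ \<Rightarrow> ('a \<times> 'b \<Rightarrow>\<^sub>0 complex)"
    by (induction P rule: infinite_finite_induct) (auto simp: htensor_of_0 htensor_of_add)
  have v: "v = (\<Sum>p\<in>Poly_Mapping.keys v. fscale (Poly_Mapping.lookup v p) (Poly_Mapping.single p 1))"
    by (rule poly_mapping_eqI)
       (auto simp: lookup_sum lookup_single when_def in_keys_iff sum.delta if_distrib cong: if_cong)
  have single: "htensor_of (Poly_Mapping.single p 1) = tensor (fst p) (snd p)" for p :: "'a \<times> 'b"
    by (simp add: tensor_def)
  show ?thesis
    by (subst v, unfold sum) (simp add: htensor_of_fscale tensor_scaleC_left single)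
qed

text \<open>
  Extension by continuity from the dense range of \<^const>\<open>htensor_of\<close>.  The bound also gives
  well-definedness: \<open>g v\<close> depends only on \<open>htensor_of v\<close>.
\<close>

lemma htensor_extension:
  fixes g :: "('a::complex_inner \<times> 'b::complex_inner \<Rightarrow>\<^sub>0 complex) \<Rightarrow> 'c::complex_hilbert_space"
  assumes add: "\<And>v w. g (v + w) = g v + g w" and scale: "\<And>c v. g (fscale c v) = c *\<^sub>C g v"
    and bound: "\<And>v. norm (g v) \<le> norm (htensor_of v) * C"
  shows "\<exists>R. bounded_clinear R \<and> (\<forall>v. R (htensor_of v) = g v)"
proof -
  have diff: "g (v - w) = g v - g w" for v w
    using add[of "v - w" w] by simp
  have "\<exists>X. (\<lambda>n. htensor_of (X n)) \<longlonglongrightarrow> z" for z :: "('a, 'b) htensor"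
  proof -
    have "z \<in> closure (range htensor_of)" by (simp add: closure_range_htensor_of)
    then obtain s where "\<forall>n. s n \<in> range htensor_of" and s: "s \<longlonglongrightarrow> z"
      unfolding closure_sequential by blast
    then have "htensor_of (inv htensor_of (s n)) = s n" for n
      by (simp add: f_inv_into_f)
    then show ?thesis
      using s by (intro exI[of _ "\<lambda>n. inv htensor_of (s n)"]) simp
  qed
  then obtain X :: "('a, 'b) htensor \<Rightarrow> nat \<Rightarrow> _" where X: "\<And>z. (\<lambda>n. htensor_of (X z n)) \<longlonglongrightarrow> z"
    by metis
  have "convergent (\<lambda>n. g (X z n))" for z
  proof (rule Cauchy_convergent)
    have cauchy: "Cauchy (\<lambda>n. htensor_of (X z n))"
      by (rule LIMSEQ_imp_Cauchy[OF X])
    show "Cauchy (\<lambda>n. g (X z n))"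
    proof (rule metric_CauchyI)
      fix e :: real assume "e > 0"
      then have "e / (\<bar>C\<bar> + 1) > 0" by (simp add: add_nonneg_pos)
      from metric_CauchyD[OF cauchy this] obtain M
        where M: "\<And>i j. i \<ge> M \<Longrightarrow> j \<ge> M \<Longrightarrow>
          dist (htensor_of (X z i)) (htensor_of (X z j)) < e / (\<bar>C\<bar> + 1)"
        by blast
      have "dist (g (X z i)) (g (X z j)) < e" if "i \<ge> M" "j \<ge> M" for i j
      proof -
        have "dist (g (X z i)) (g (X z j)) \<le> dist (htensor_of (X z i)) (htensor_of (X z j)) * C"
          using bound[of "X z i - X z j"] by (simp add: dist_norm diff htensor_of_diff)
        also have "\<dots> \<le> dist (htensor_of (X z i)) (htensor_of (X z j)) * (\<bar>C\<bar> + 1)"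
          by (intro mult_left_mono) auto
        also have "\<dots> < e"
          using M[OF that] by (simp add: pos_less_divide_eq add_nonneg_pos)
        finally show ?thesis .
      qed
      then show "\<exists>M. \<forall>i\<ge>M. \<forall>j\<ge>M. dist (g (X z i)) (g (X z j)) < e" by blast
    qed
  qed
  then obtain R where R: "\<And>z. (\<lambda>n. g (X z n)) \<longlonglongrightarrow> R z"
    unfolding convergent_def by metis
  have R_eq: "L = R z" if "(\<lambda>n. htensor_of (Y n)) \<longlonglongrightarrow> z" "(\<lambda>n. g (Y n)) \<longlonglongrightarrow> L" for Y z L
  proof -
    have "(\<lambda>n. norm (htensor_of (Y n) - htensor_of (X z n)) * C) \<longlonglongrightarrow> norm (z - z) * C"
      by (intro tendsto_intros that X)
    then have null: "(\<lambda>n. norm (htensor_of (Y n) - htensor_of (X z n)) * C) \<longlonglongrightarrow> 0"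
      by simp
    have "norm (g (Y n) - g (X z n)) \<le> norm (htensor_of (Y n) - htensor_of (X z n)) * C" for n
      using bound[of "Y n - X z n"] by (simp add: diff htensor_of_diff)
    then have "(\<lambda>n. g (Y n) - g (X z n)) \<longlonglongrightarrow> 0"
      by (intro Lim_null_comparison[OF _ null] always_eventually) blast
    then have "L - R z = 0"
      by (rule LIMSEQ_unique[OF tendsto_diff[OF that(2) R]])
    then show ?thesis by simp
  qed
  have tendsto_scaleC: "(\<lambda>n. c *\<^sub>C f n) \<longlonglongrightarrow> c *\<^sub>C l" if "f \<longlonglongrightarrow> l"
    for c and f :: "nat \<Rightarrow> 'd::complex_inner" and l
  proof -
    have "(\<lambda>n. cmod c * norm (f n - l)) \<longlonglongrightarrow> cmod c * norm (l - l)"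
      by (intro tendsto_intros that)
    then have "(\<lambda>n. norm (c *\<^sub>C (f n - l))) \<longlonglongrightarrow> 0"
      by (simp add: cinner.snorm_scale)
    then show ?thesis
      by (subst LIM_zero_iff[symmetric])
         (simp add: tendsto_norm_zero_iff complex_vector.scale_right_diff_distrib)
  qed
  have "bounded_clinear R"
  proof (rule bounded_clinear_intro)
    show "R (x + y) = R x + R y" for x y
      by (rule R_eq[symmetric, of "\<lambda>n. X x n + X y n"])
         (simp_all add: add htensor_of_add tendsto_add X R)
    show "R (c *\<^sub>C x) = c *\<^sub>C R x" for c x
      by (rule R_eq[symmetric, of "\<lambda>n. fscale c (X x n)"])
         (simp_all add: scale htensor_of_fscale tendsto_scaleC X R)
    show "norm (R x) \<le> norm x * C" for x
      by (rule LIMSEQ_le[OF tendsto_norm[OF R] tendsto_mult_right[OF tendsto_norm[OF X]]])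
         (use bound in blast)
  qed
  moreover have "R (htensor_of v) = g v" for v
    by (rule R_eq[symmetric, of "\<lambda>_. v"]) simp_all
  ultimately show ?thesis by blast
qed

lemma tensor_op_exists:
  fixes S :: "'a::complex_inner \<Rightarrow> 'a" and T :: "'b::complex_inner \<Rightarrow> 'b"
  assumes S: "bounded_clinear S" and T: "bounded_clinear T"
  shows "\<exists>R. bounded_clinear R \<and> (\<forall>a b. R (tensor a b) = tensor (S a) (T b))"
proof -
  define g where "g v = (\<Sum>p\<in>Poly_Mapping.keys v.
    Poly_Mapping.lookup v p *\<^sub>C tensor (S (fst p)) (T (snd p)))" for v :: "'a \<times> 'b \<Rightarrow>\<^sub>0 complex"
  have superset: "g v = (\<Sum>p\<in>P. Poly_Mapping.lookup v p *\<^sub>C tensor (S (fst p)) (T (snd p)))"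
    if "finite P" "Poly_Mapping.keys v \<subseteq> P" for v P
    unfolding g_def using that by (intro sum.mono_neutral_left) (auto simp: in_keys_iff)
  obtain K where K: "0 \<le> K" "\<And>x. norm (S x) \<le> norm x * K"
    using bounded_linear.nonneg_bounded[OF bounded_clinearD(1)[OF S]] by blast
  obtain L where L: "0 \<le> L" "\<And>x. norm (T x) \<le> norm x * L"
    using bounded_linear.nonneg_bounded[OF bounded_clinearD(1)[OF T]] by blast
  have "\<exists>R. bounded_clinear R \<and> (\<forall>v. R (htensor_of v) = g v)"
  proof (rule htensor_extension)
    fix v w :: "'a \<times> 'b \<Rightarrow>\<^sub>0 complex" and c
    let ?P = "Poly_Mapping.keys v \<union> Poly_Mapping.keys w"
    have "Poly_Mapping.keys (v + w) \<subseteq> ?P" by (rule Poly_Mapping.keys_add)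
    then show "g (v + w) = g v + g w"
      using superset[of ?P "v + w"] superset[of ?P v] superset[of ?P w]
      by (simp add: lookup_add scaleC_add_left sum.distrib)
    show "g (fscale c v) = c *\<^sub>C g v"
      using superset[OF _ keys_fscale, of v c]
      by (simp add: g_def complex_vector.scale_sum_right)
    show "norm (g v) \<le> norm (htensor_of v) * (K * L)"
      using norm_tensor_sum_map[OF S K T L, of "Poly_Mapping.keys v"
          "\<lambda>p. Poly_Mapping.lookup v p *\<^sub>C fst p" snd]
      by (simp add: htensor_of_eq_sum g_def bounded_clinearD(2)[OF S] tensor_scaleC_left)
  qed
  then obtain R where "bounded_clinear R" and R: "\<And>v. R (htensor_of v) = g v" by blast
  moreover have "R (tensor a b) = tensor (S a) (T b)" for a b
    by (simp add: tensor_def[of a b] R g_def scaleC_one)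
  ultimately show ?thesis by blast
qed

text \<open>
  Elementary tensors span a dense subspace; this is the form in which density is used, both for
  operators that agree on elementary tensors and for vectors with equal inner products against them.
\<close>

lemma tensor_total:
  fixes W :: "('a::complex_inner, 'b::complex_inner) htensor set"
  assumes "closed W" "complex_vector.subspace W" "\<And>a b. tensor a b \<in> W"
  shows "z \<in> W"
proof -
  have "cspan {tensor a b |a b. True} \<subseteq> W"
    by (rule complex_vector.span_minimal) (use assms in auto)
  then have "closure (cspan {tensor a b |a b. True}) \<subseteq> W"
    using assms(1) by (rule closure_minimal)
  then show ?thesis unfolding closure_cspan_tensor by blast
qed

lemma bounded_clinear_tensor_eqI:
  fixes A B :: "('a::complex_inner, 'b::complex_inner) htensor \<Rightarrow> 'c::complex_inner"
  assumes A: "bounded_clinear A" and B: "bounded_clinear B"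
    and eq: "\<And>a b. A (tensor a b) = B (tensor a b)"
  shows "A = B"
proof
  fix z
  interpret A: bounded_linear A by (rule bounded_clinearD[OF A])
  interpret B: bounded_linear B by (rule bounded_clinearD[OF B])
  have "z \<in> {z. A z = B z}"
  proof (rule tensor_total)
    show "closed {z. A z = B z}"
      by (intro closed_Collect_eq continuous_intros A.continuous_on B.continuous_on)
    show "complex_vector.subspace {z. A z = B z}"
      by (simp add: complex_vector.subspace_def A.zero B.zero A.add B.add
          bounded_clinearD(2)[OF A] bounded_clinearD(2)[OF B])
  qed (simp add: eq)
  then show "A z = B z" by simp
qed

lemma tensor_op_eqI:
  fixes S :: "'a::complex_inner \<Rightarrow> 'a" and T :: "'b::complex_inner \<Rightarrow> 'b"
  assumes "bounded_clinear R" and "\<And>a b. R (tensor a b) = tensor (S a) (T b)"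
  shows "tensor_op S T = R"
  unfolding tensor_op_def
  by (rule the_equality) (use assms in \<open>auto intro: bounded_clinear_tensor_eqI\<close>)

lemma
  fixes S :: "'a::complex_inner \<Rightarrow> 'a" and T :: "'b::complex_inner \<Rightarrow> 'b"
  assumes "bounded_clinear S" and "bounded_clinear T"
  shows bounded_clinear_tensor_op: "bounded_clinear (tensor_op S T)"
    and tensor_op_tensor: "tensor_op S T (tensor a b) = tensor (S a) (T b)"
  using tensor_op_exists[OF assms] tensor_op_eqI[of _ S T] by metis+

lemma tensor_op_comp:
  assumes "bounded_clinear S" "bounded_clinear T" "bounded_clinear S'" "bounded_clinear T'"
  shows "tensor_op S T \<circ> tensor_op S' T' = tensor_op (S \<circ> S') (T \<circ> T')"
  by (rule tensor_op_eqI[symmetric])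
     (simp_all add: assms bounded_clinear_comp bounded_clinear_tensor_op tensor_op_tensor)

lemma cinner_tensor_eqI:
  fixes y z :: "('a::complex_inner, 'b::complex_inner) htensor"
  assumes "\<And>a b. cinner (tensor a b) y = cinner (tensor a b) z"
  shows "y = z"
proof (rule cinner_eqI)
  fix x
  have lin: "bounded_linear (\<lambda>x. cinner x w)" for w :: "('a, 'b) htensor"
  proof (rule bounded_linear_intro)
    show "cinner (r *\<^sub>R x) w = r *\<^sub>R cinner x w" for r x
      by (simp add: cinner_scaleC_left scaleR_conv_of_real flip: scaleC_of_real)
    show "norm (cinner x w) \<le> norm x * norm w" for x
      by (rule cinner.Cauchy_Schwarz)
  qed (simp add: cinner_add_left)
  have "x \<in> {x. cinner x y = cinner x z}"
  proof (rule tensor_total)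
    show "closed {x. cinner x y = cinner x z}"
      by (intro closed_Collect_eq linear_continuous_on lin)
    show "complex_vector.subspace {x. cinner x y = cinner x z}"
      by (simp add: complex_vector.subspace_def cinner_add_left cinner_scaleC_left)
  qed (simp add: assms)
  then show "cinner x y = cinner x z" by simp
qed

text \<open>
  The adjoint of \<open>S \<otimes> T\<close> exists because \<open>S \<otimes> T\<close> is bounded; inner products against elementary
  tensors show that it has the property that determines \<open>S\<^sup>* \<otimes> T\<^sup>*\<close>.
\<close>

lemma adjoint_op_tensor_op:
  fixes S :: "'a::complex_hilbert_space \<Rightarrow> 'a" and T :: "'b::complex_hilbert_space \<Rightarrow> 'b"
  assumes S: "bounded_clinear S" and T: "bounded_clinear T"
  shows "adjoint_op (tensor_op S T) = tensor_op (adjoint_op S) (adjoint_op T)"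
proof (rule tensor_op_eqI[symmetric])
  note ST = bounded_clinear_tensor_op[OF S T]
  show "bounded_clinear (adjoint_op (tensor_op S T))"
    by (rule bounded_clinear_adjoint_op[OF ST])
  show "adjoint_op (tensor_op S T) (tensor a b) = tensor (adjoint_op S a) (adjoint_op T b)" for a b
    by (rule cinner_tensor_eqI)
       (simp add: cinner_adjoint_op ST S T tensor_op_tensor cinner_tensor)
qed

section \<open>Defects of operators acting on one tensor factor\<close>

lemma tensor_op_funpow:
  assumes "bounded_clinear S" "bounded_clinear T"
  shows "(tensor_op S T ^^ k) (tensor a b) = tensor ((S ^^ k) a) ((T ^^ k) b)"
  by (induction k) (simp_all add: tensor_op_tensor assms)

lemma bounded_clinear_funpow:
  fixes A :: "'a::complex_inner \<Rightarrow> 'a"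
  shows "bounded_clinear A \<Longrightarrow> bounded_clinear (A ^^ k)"
  by (induction k) (simp_all add: bounded_clinear_id bounded_clinear_comp)

lemma bounded_clinear_zero: "bounded_clinear (\<lambda>_. 0)"
  by (simp add: bounded_clinear_def bounded_linear_zero)

lemma bounded_clinear_defect:
  fixes A B :: "'a::complex_inner \<Rightarrow> 'a"
  assumes "bounded_clinear A" "bounded_clinear B"
  shows "bounded_clinear (defect m A B)"
proof -
  have scale: "bounded_clinear (\<lambda>x. c *\<^sub>C X x)" if X: "bounded_clinear X" for c and X :: "'a \<Rightarrow> 'a"
  proof -
    interpret X: bounded_linear X by (rule bounded_clinearD[OF X])
    obtain K where "\<And>x. norm (X x) \<le> norm x * K" using X.bounded by blast
    then have "cmod c * norm (X x) \<le> norm x * (cmod c * K)" for x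
      using mult_left_mono[of "norm (X x)" "norm x * K" "cmod c"] by (simp add: mult_ac)
    then show ?thesis
      by (intro bounded_clinear_intro[where K = "cmod c * K"])
         (simp_all add: X.add scaleC_add_right bounded_clinearD(2)[OF X] mult.commute
            cinner.snorm_scale)
  qed
  have sum: "bounded_clinear (\<lambda>x. \<Sum>j\<in>J. f j x)" if "\<And>j. bounded_clinear (f j)"
    for J and f :: "nat \<Rightarrow> 'a \<Rightarrow> 'a"
    using that unfolding bounded_clinear_def
    by (auto intro: bounded_linear_sum simp: complex_vector.scale_sum_right)
  have "bounded_clinear (\<lambda>x. (A ^^ k) ((B ^^ k) x))" for k
    using bounded_clinear_comp[OF bounded_clinear_funpow[OF assms(1)] bounded_clinear_funpow[OF assms(2)]]
    by (simp add: o_def)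
  then show ?thesis
    unfolding defect_def by (intro sum scale)
qed

lemma tensor_sum_left: "tensor (\<Sum>j\<in>J. f j) b = (\<Sum>j\<in>J. tensor (f j) b)"
  using tensor_scaleC_left[of 0 0 b]
  by (induction J rule: infinite_finite_induct) (auto simp: tensor_add_left)

lemma tensor_sum_right: "tensor a (\<Sum>j\<in>J. f j) = (\<Sum>j\<in>J. tensor a (f j))"
  using tensor_scaleC_right[of a 0 0]
  by (induction J rule: infinite_finite_induct) (auto simp: tensor_add_right)

lemma id_funpow: "id ^^ k = id"
  by (induction k) auto

lemma defect_tensor_left:
  assumes "bounded_clinear A" "bounded_clinear B"
  shows "defect m (tensor_op A id) (tensor_op B id) (tensor a b) = tensor (defect m A B a) b"
  by (simp add: defect_def tensor_op_funpow assms bounded_clinear_id id_funpow tensor_sum_left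
      tensor_scaleC_left)

lemma defect_tensor_right:
  assumes "bounded_clinear A" "bounded_clinear B"
  shows "defect m (tensor_op id A) (tensor_op id B) (tensor a b) = tensor a (defect m A B b)"
  by (simp add: defect_def tensor_op_funpow assms bounded_clinear_id id_funpow tensor_sum_right
      tensor_scaleC_right)

text \<open>
  \<open>S1 = S \<otimes> I\<close> and \<open>T1 = I \<otimes> T\<close> commute with product \<open>S \<otimes> T\<close>.  Their hypotheses are
  identities between bounded operators, so checking them on elementary tensors is enough.
\<close>

theorem quasi_isometric_tensor_product:
  fixes S :: "'a::complex_hilbert_space \<Rightarrow> 'a" and T :: "'b::complex_hilbert_space \<Rightarrow> 'b"
  assumes S: "bounded_clinear S" and T: "bounded_clinear T"
    and S_quasi: "(adjoint_op S ^^ n) \<circ> defect m1 (adjoint_op S) S \<circ> (S ^^ n) = (\<lambda>_. 0)"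
    and T_isom: "defect m2 (adjoint_op T) T = (\<lambda>_. 0)"
  shows "(adjoint_op (tensor_op S T) ^^ n) \<circ>
    defect (m1 + m2 - 1) (tensor_op (adjoint_op S) (adjoint_op T)) (tensor_op S T) \<circ>
    (tensor_op S T ^^ n) = (\<lambda>_. 0)"
proof -
  define S1 :: "('a, 'b) htensor \<Rightarrow> _" where "S1 = tensor_op S id"
  define T1 :: "('a, 'b) htensor \<Rightarrow> _" where "T1 = tensor_op id T"
  note adj = bounded_clinear_adjoint_op
  note bounded = S T adj[OF S] adj[OF T] bounded_clinear_id
  have S1: "bounded_clinear S1" and T1: "bounded_clinear T1"
    unfolding S1_def T1_def by (simp_all add: bounded bounded_clinear_tensor_op)
  have S1_adj: "adjoint_op S1 = tensor_op (adjoint_op S) id"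
    and T1_adj: "adjoint_op T1 = tensor_op id (adjoint_op T)"
    unfolding S1_def T1_def by (simp_all add: bounded adjoint_op_tensor_op adjoint_op_id)
  have ST: "S1 \<circ> T1 = tensor_op S T" "T1 \<circ> S1 = tensor_op S T"
    "adjoint_op S1 \<circ> adjoint_op T1 = tensor_op (adjoint_op S) (adjoint_op T)"
    unfolding S1_adj T1_adj unfolding S1_def T1_def by (simp_all add: tensor_op_comp bounded)
  have zero: "tensor 0 b = 0" "tensor a 0 = 0" for a :: 'a and b :: 'b
    using tensor_sum_left[of "\<lambda>_. 0" "{}" b] tensor_sum_right[of a "\<lambda>_. 0" "{}"] by simp_all
  have S1_quasi: "(adjoint_op S1 ^^ n) \<circ> defect m1 (adjoint_op S1) S1 \<circ> (S1 ^^ n) = (\<lambda>_. 0)"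
  proof (rule bounded_clinear_tensor_eqI)
    show "((adjoint_op S1 ^^ n) \<circ> defect m1 (adjoint_op S1) S1 \<circ> (S1 ^^ n)) (tensor a b) = 0" for a b
      using fun_cong[OF S_quasi, of a] unfolding S1_adj unfolding S1_def
      by (simp add: bounded tensor_op_funpow defect_tensor_left zero)
  qed (intro bounded_clinear_comp bounded_clinear_funpow bounded_clinear_defect
      bounded_clinear_zero adj S1)+
  have T1_isom: "defect m2 (adjoint_op T1) T1 = (\<lambda>_. 0)"
  proof (rule bounded_clinear_tensor_eqI)
    show "defect m2 (adjoint_op T1) T1 (tensor a b) = 0" for a b
      unfolding T1_adj unfolding T1_def by (simp add: bounded defect_tensor_right T_isom zero)
  qed (intro bounded_clinear_defect bounded_clinear_zero adj T1)+
  show ?thesis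
    using quasi_isometric_product[OF S1 T1 _ S1_quasi T1_isom] by (simp add: ST)
qed

section \<open>Products and tensor products of quasi-isometric operators\<close>

theorem corollary4p6:
  fixes S T :: "'h::complex_hilbert_space \<Rightarrow> 'h"
    and n m1 m2 :: nat
  assumes infinite_dimensional: "\<not> (\<exists>B :: 'h set. finite B \<and> cspan B = UNIV)"
    and "n \<ge> 1" and "m1 \<ge> 1" and "m2 \<ge> 1"
    and "bounded_clinear S" and "bounded_clinear T"
    and S_quasi: "(adjoint_op S ^^ n) \<circ> defect m1 (adjoint_op S) S \<circ> (S ^^ n) = (\<lambda>_. 0)"
    and T_isom: "defect m2 (adjoint_op T) T = (\<lambda>_. 0)"
  shows "(S \<circ> T = T \<circ> S \<longrightarrow>
      (adjoint_op (S \<circ> T) ^^ n) \<circ>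
        defect (m1 + m2 - 1) (adjoint_op S \<circ> adjoint_op T) (S \<circ> T) \<circ> ((S \<circ> T) ^^ n) = (\<lambda>_. 0))
    \<and> (adjoint_op (tensor_op S T) ^^ n) \<circ>
        defect (m1 + m2 - 1) (tensor_op (adjoint_op S) (adjoint_op T)) (tensor_op S T) \<circ>
        (tensor_op S T ^^ n) = (\<lambda>_. 0)"
  using quasi_isometric_product[OF assms(5,6) _ S_quasi T_isom]
    quasi_isometric_tensor_product[OF assms(5,6) S_quasi T_isom]
  by blast

end
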